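(* The $M$-vertex-stabilizer problem admits a polynomial-time 2-approximation algorithm. Furthermore, if $M$ is a maximum-weight matching in $G\setminus S_1$, then the problem is polynomial-time solvable.
   Context: Let $G=(V,E)$ be a finite simple undirected graph with edge weights $w\in\mathbb{R}^E_{\ge0}$ and $M$ a matching of $G$. An $M$-vertex-stabilizer is a set $S\subseteq V$ such that $G\setminus S:=G[V\setminus S]$ is stable and $M$ is a maximum-weight matching of $G\setminus S$; the problem asks for one of minimum cardinality (instances may be infeasible). A weighted graph is stable if its maximum matching weight equals $\max\{w^\top x: x\ge0,\ x(\delta(v))\le1\ \forall v\}$. A path/cycle is $M$-alternating if its edges alternately belong to $M$ and $E\setminus M$; an $M$-alternating path is valid if it starts with an $M$-exposed vertex or an edge of $M$ and ends with an $M$-exposed vertex or an edge of $M$; a valid $M$-alternating path $P$ is $M$-augmenting if $w(P\setminus M)>w(P\cap M)$. An $M$-blossom is an odd cycle $C=(e_1,\dots,e_{2k+1})$ with $e_i\in M$ for even $i$ and $e_i\notin M$ for odd $i$; its base is $e_1\cap e_{2k+1}$. An $M$-flower $C\cup P$ consists of an $M$-blossom $C$ with base $v_1$ and a valid $M$-alternating path $P=(v_1,\dots,v_k)$ with $v_1v_2\in M$; $v_k$ is its root; it is augmenting if $w(C\setminus M)+2w(P\setminus M)>w(C\cap M)+2w(P\cap M)$ (a single $M$-blossom with $M$-exposed base $v$ and $w(C\setminus M)>w(C\cap M)$ counts as an augmenting flower with root $v$). $S_1$ denotes the set of $M$-exposed vertices of $G$ that are roots of $M$-augmenting flowers or endpoints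 of $M$-augmenting paths whose other endpoint is $M$-covered. *)

theory Defs
  imports Complex_Main "HOL-Computational_Algebra.Polynomial"
begin

section \<open>Weighted graphs, matchings and stability\<close>

text \<open>A graph is given by its vertex set and its set of edges, each edge being a two-element set
  of vertices.\<close>

definition simple_graph :: "'a set \<Rightarrow> 'a set set \<Rightarrow> bool" where
  "simple_graph V E \<longleftrightarrow> finite V \<and> (\<forall>e\<in>E. e \<subseteq> V \<and> card e = 2)"

definition induced_edges :: "'a set set \<Rightarrow> 'a set \<Rightarrow> 'a set set" where
  "induced_edges E U = {e \<in> E. e \<subseteq> U}"

definition matching :: "'a set set \<Rightarrow> 'a set set \<Rightarrow> bool" where
  "matching E M \<longleftrightarrow> M \<subseteq> E \<and> (\<forall>e\<in>M. \<forall>f\<in>M. e \<noteq> f \<longrightarrow> e \<inter> f = {})"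

definition max_weight_matching :: "'a set set \<Rightarrow> ('a set \<Rightarrow> real) \<Rightarrow> 'a set set \<Rightarrow> bool" where
  "max_weight_matching E w M \<longleftrightarrow> matching E M \<and> (\<forall>N. matching E N \<longrightarrow> sum w N \<le> sum w M)"

definition fractional_matching :: "'a set \<Rightarrow> 'a set set \<Rightarrow> ('a set \<Rightarrow> real) \<Rightarrow> bool" where
  "fractional_matching V E x \<longleftrightarrow>
     (\<forall>e\<in>E. x e \<ge> 0) \<and> (\<forall>v\<in>V. (\<Sum>e\<in>{e \<in> E. v \<in> e}. x e) \<le> 1)"

text \<open>On the right-hand side the supremum is a maximum, since it is taken over the values of a
  linear function on a nonempty compact polytope.\<close>

definition stable :: "'a set \<Rightarrow> 'a set set \<Rightarrow> ('a set \<Rightarrow> real) \<Rightarrow> bool" where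
  "stable V E w \<longleftrightarrow>
     Max {sum w N | N. matching E N} = Sup {\<Sum>e\<in>E. w e * x e | x. fractional_matching V E x}"

section \<open>The stabilizer problem\<close>

definition stabilizer_instance ::
    "'a set \<Rightarrow> 'a set set \<Rightarrow> ('a set \<Rightarrow> real) \<Rightarrow> 'a set set \<Rightarrow> bool" where
  "stabilizer_instance V E w M \<longleftrightarrow> simple_graph V E \<and> (\<forall>e\<in>E. w e \<ge> 0) \<and> matching E M"

definition vertex_stabilizer ::
    "'a set \<Rightarrow> 'a set set \<Rightarrow> ('a set \<Rightarrow> real) \<Rightarrow> 'a set set \<Rightarrow> 'a set \<Rightarrow> bool" where
  "vertex_stabilizer V E w M S \<longleftrightarrow>
     S \<subseteq> V \<and> stable (V - S) (induced_edges E (V - S)) w \<and>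
     max_weight_matching (induced_edges E (V - S)) w M"

text \<open>An algorithm either reports infeasibility (\<^term>\<open>None\<close>) or returns a set of vertices.\<close>

definition approx_answer ::
    "real \<Rightarrow> 'a set \<Rightarrow> 'a set set \<Rightarrow> ('a set \<Rightarrow> real) \<Rightarrow> 'a set set \<Rightarrow> 'a set option \<Rightarrow> bool" where
  "approx_answer \<alpha> V E w M r \<longleftrightarrow>
     (case r of
        None \<Rightarrow> \<not> (\<exists>S. vertex_stabilizer V E w M S)
      | Some S \<Rightarrow> vertex_stabilizer V E w M S \<and>
          (\<forall>T. vertex_stabilizer V E w M T \<longrightarrow> real (card S) \<le> \<alpha> * real (card T)))"

definition optimal_answer ::
    "'a set \<Rightarrow> 'a set set \<Rightarrow> ('a set \<Rightarrow> real) \<Rightarrow> 'a set set \<Rightarrow> 'a set option \<Rightarrow> bool" where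
  "optimal_answer V E w M r \<longleftrightarrow>
     (case r of
        None \<Rightarrow> \<not> (\<exists>S. vertex_stabilizer V E w M S)
      | Some S \<Rightarrow> vertex_stabilizer V E w M S \<and>
          (\<forall>T. vertex_stabilizer V E w M T \<longrightarrow> card S \<le> card T))"

section \<open>Augmenting paths and flowers\<close>

definition covered :: "'a set set \<Rightarrow> 'a \<Rightarrow> bool" where
  "covered M v \<longleftrightarrow> (\<exists>e\<in>M. v \<in> e)"

abbreviation exposed :: "'a set set \<Rightarrow> 'a \<Rightarrow> bool" where
  "exposed M v \<equiv> \<not> covered M v"

definition walk_edges :: "'a list \<Rightarrow> 'a set list" where
  "walk_edges vs = map (\<lambda>i. {vs ! i, vs ! Suc i}) [0..<length vs - 1]"

definition alternating_path ::
    "'a set \<Rightarrow> 'a set set \<Rightarrow> 'a set set \<Rightarrow> 'a list \<Rightarrow> bool" where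
  "alternating_path V E M vs \<longleftrightarrow>
     vs \<noteq> [] \<and> distinct vs \<and> set vs \<subseteq> V \<and> set (walk_edges vs) \<subseteq> E \<and>
     (\<forall>i. Suc i < length (walk_edges vs) \<longrightarrow>
        (walk_edges vs ! i \<in> M) \<noteq> (walk_edges vs ! Suc i \<in> M))"

definition valid_path ::
    "'a set \<Rightarrow> 'a set set \<Rightarrow> 'a set set \<Rightarrow> 'a list \<Rightarrow> bool" where
  "valid_path V E M vs \<longleftrightarrow>
     alternating_path V E M vs \<and>
     (exposed M (hd vs) \<or> walk_edges vs \<noteq> [] \<and> hd (walk_edges vs) \<in> M) \<and>
     (exposed M (last vs) \<or> walk_edges vs \<noteq> [] \<and> last (walk_edges vs) \<in> M)"

definition augmenting_path ::
    "'a set \<Rightarrow> 'a set set \<Rightarrow> ('a set \<Rightarrow> real) \<Rightarrow> 'a set set \<Rightarrow> 'a list \<Rightarrow> bool" where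
  "augmenting_path V E w M vs \<longleftrightarrow>
     valid_path V E M vs \<and>
     sum w (set (walk_edges vs) - M) > sum w (set (walk_edges vs) \<inter> M)"

text \<open>The list \<open>cs\<close> contains each vertex of the cycle once, starting with the base. Edges are
  numbered from 0 here, so those at odd positions are the ones in \<open>M\<close>.\<close>

definition cycle_edges :: "'a list \<Rightarrow> 'a set list" where
  "cycle_edges cs = walk_edges (cs @ [hd cs])"

definition blossom ::
    "'a set \<Rightarrow> 'a set set \<Rightarrow> 'a set set \<Rightarrow> 'a list \<Rightarrow> bool" where
  "blossom V E M cs \<longleftrightarrow>
     length cs \<ge> 3 \<and> odd (length cs) \<and> distinct cs \<and> set cs \<subseteq> V \<and>
     set (cycle_edges cs) \<subseteq> E \<and>
     (\<forall>i < length cs. cycle_edges cs ! i \<in> M \<longleftrightarrow> odd i)"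

text \<open>The second disjunct is the degenerate flower: a blossom alone, with exposed base.\<close>

definition augmenting_flower_root ::
    "'a set \<Rightarrow> 'a set set \<Rightarrow> ('a set \<Rightarrow> real) \<Rightarrow> 'a set set \<Rightarrow> 'a \<Rightarrow> bool" where
  "augmenting_flower_root V E w M v \<longleftrightarrow>
     (\<exists>cs vs. blossom V E M cs \<and> valid_path V E M vs \<and> length vs \<ge> 2 \<and>
        hd vs = hd cs \<and> {vs ! 0, vs ! 1} \<in> M \<and> last vs = v \<and>
        sum w (set (cycle_edges cs) - M) + 2 * sum w (set (walk_edges vs) - M)
          > sum w (set (cycle_edges cs) \<inter> M) + 2 * sum w (set (walk_edges vs) \<inter> M)) \<or>
     (\<exists>cs. blossom V E M cs \<and> hd cs = v \<and> exposed M v \<and>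
        sum w (set (cycle_edges cs) - M) > sum w (set (cycle_edges cs) \<inter> M))"

definition S1 ::
    "'a set \<Rightarrow> 'a set set \<Rightarrow> ('a set \<Rightarrow> real) \<Rightarrow> 'a set set \<Rightarrow> 'a set" where
  "S1 V E w M =
     {v \<in> V. exposed M v \<and>
        (augmenting_flower_root V E w M v \<or>
         (\<exists>vs. augmenting_path V E w M vs \<and> hd vs = v \<and> covered M (last vs)))}"

section \<open>Polynomial time over real inputs\<close>

text \<open>
  Edge weights are arbitrary reals, so the model of computation is an additive random access
  machine over the ordered group of the reals (a Blum-Shub-Smale style machine with indirect
  addressing), programmed by while programs. It has a memory of natural numbers, used for
  addresses, counters and combinatorial data, and a memory of reals, used for weights. The only
  operations on either sort are addition, subtraction and comparison, the program constants are
  rational, and a real number can influence the natural numbers only through the outcome of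
  comparisons. There is neither multiplication nor rounding, so that unit cost is adequate:
  in \<open>t\<close> steps on rational data all numbers keep a bit length polynomial in \<open>t\<close> and the bit length
  of the data, and hence a program running in polynomial time in this model runs in polynomial
  time on a Turing machine when its inputs are rational numbers in binary.
\<close>

datatype nexp =
    NConst nat
  | NLoad nexp
  | NPlus nexp nexp
  | NMinus nexp nexp

datatype rexp =
    RConst rat
  | RLoad nexp
  | RPlus rexp rexp
  | RMinus rexp rexp

datatype cond =
    NLess nexp nexp
  | RLess rexp rexp
  | Neg cond
  | Conj cond cond

datatype prog =
    Skip
  | NStore nexp nexp
  | RStore nexp rexp
  | Seq prog prog
  | Cond cond prog prog
  | While cond prog

type_synonym memory = "(nat \<Rightarrow> nat) \<times> (nat \<Rightarrow> real)"

fun nval :: "nexp \<Rightarrow> memory \<Rightarrow> nat" where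
  "nval (NConst k) m = k"
| "nval (NLoad a) m = fst m (nval a m)"
| "nval (NPlus a b) m = nval a m + nval b m"
| "nval (NMinus a b) m = nval a m - nval b m"

fun rval :: "rexp \<Rightarrow> memory \<Rightarrow> real" where
  "rval (RConst q) m = of_rat q"
| "rval (RLoad a) m = snd m (nval a m)"
| "rval (RPlus a b) m = rval a m + rval b m"
| "rval (RMinus a b) m = rval a m - rval b m"

fun cval :: "cond \<Rightarrow> memory \<Rightarrow> bool" where
  "cval (NLess a b) m \<longleftrightarrow> nval a m < nval b m"
| "cval (RLess a b) m \<longleftrightarrow> rval a m < rval b m"
| "cval (Neg c) m \<longleftrightarrow> \<not> cval c m"
| "cval (Conj c d) m \<longleftrightarrow> cval c m \<and> cval d m"

text \<open>\<open>exec p m t m'\<close>: started in memory \<open>m\<close>, the program \<open>p\<close> halts after \<open>t\<close> steps in memory \<open>m'\<close>.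
  A step is a skip, an assignment or a test. The expressions in a fixed program have bounded size,
  so charging one unit for evaluating each of them changes the running time only by a
  constant factor.\<close>

inductive exec :: "prog \<Rightarrow> memory \<Rightarrow> nat \<Rightarrow> memory \<Rightarrow> bool" where
  Skip: "exec Skip m 1 m"
| NStore: "exec (NStore a b) m 1 ((fst m)(nval a m := nval b m), snd m)"
| RStore: "exec (RStore a r) m 1 (fst m, (snd m)(nval a m := rval r m))"
| Seq: "exec p m t m' \<Longrightarrow> exec q m' u m'' \<Longrightarrow> exec (Seq p q) m (t + u) m''"
| CondTrue: "cval c m \<Longrightarrow> exec p m t m' \<Longrightarrow> exec (Cond c p q) m (Suc t) m'"
| CondFalse: "\<not> cval c m \<Longrightarrow> exec q m t m' \<Longrightarrow> exec (Cond c p q) m (Suc t) m'"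
| WhileFalse: "\<not> cval c m \<Longrightarrow> exec (While c p) m 1 m"
| WhileTrue: "cval c m \<Longrightarrow> exec p m t m' \<Longrightarrow> exec (While c p) m' u m'' \<Longrightarrow>
    exec (While c p) m (Suc (t + u)) m''"

inductive_cases exec_SkipE: "exec Skip m t m'"
inductive_cases exec_NStoreE: "exec (NStore a b) m t m'"
inductive_cases exec_RStoreE: "exec (RStore a r) m t m'"
inductive_cases exec_SeqE: "exec (Seq p q) m t m'"
inductive_cases exec_CondE: "exec (Cond c p q) m t m'"
inductive_cases exec_WhileE: "exec (While c p) m t m'"

lemma exec_deterministic:
  "exec p m t m' \<Longrightarrow> exec p m u m'' \<Longrightarrow> u = t \<and> m'' = m'"
proof (induction arbitrary: u m'' rule: exec.induct)
  case Skip
  then show ?case by (auto elim: exec_SkipE)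
next
  case NStore
  then show ?case by (auto elim: exec_NStoreE)
next
  case RStore
  then show ?case by (auto elim: exec_RStoreE)
next
  case Seq
  from Seq.prems show ?case by (rule exec_SeqE) (use Seq.IH in blast)
next
  case CondTrue
  from CondTrue.prems show ?case
    by (rule exec_CondE) (use CondTrue.hyps CondTrue.IH in blast)+
next
  case CondFalse
  from CondFalse.prems show ?case
    by (rule exec_CondE) (use CondFalse.hyps CondFalse.IH in blast)+
next
  case WhileFalse
  from WhileFalse.prems show ?case
    by (rule exec_WhileE) (use WhileFalse.hyps in simp_all)
next
  case WhileTrue
  from WhileTrue.prems show ?case
    by (rule exec_WhileE) (use WhileTrue.hyps WhileTrue.IH in blast)+
qed

text \<open>
  Inputs are graphs on the vertices \<open>0, ..., n - 1\<close>. Cell 0 of the natural number memory holds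
  \<open>n\<close>, and the following \<open>n * n\<close> cells hold the adjacency matrix by rows, with entry 2 for an edge
  of the matching and 1 for any other edge. The first \<open>n * n\<close> cells of the real memory hold the
  weight matrix by rows, with entry 0 for non-edges. All other cells are 0.
\<close>

definition encode ::
    "nat \<Rightarrow> nat set set \<Rightarrow> (nat set \<Rightarrow> real) \<Rightarrow> nat set set \<Rightarrow> memory" where
  "encode n E w M =
     ((\<lambda>a. if a = 0 then n
           else if a \<le> n * n then
             (let e = {(a - 1) div n, (a - 1) mod n}
              in if e \<in> M then 2 else if e \<in> E then 1 else 0)
           else 0),
      (\<lambda>a. if a < n * n \<and> {a div n, a mod n} \<in> E then w {a div n, a mod n} else 0))"

text \<open>On halting, cell 0 of the natural number memory is 0 iff the answer is \<^term>\<open>None\<close>, and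
  otherwise the returned set consists of the vertices \<open>v\<close> for which cell \<open>v + 1\<close> is nonzero.\<close>

definition decode :: "nat \<Rightarrow> memory \<Rightarrow> nat set option" where
  "decode n m = (if fst m 0 = 0 then None else Some {v. v < n \<and> fst m (v + 1) \<noteq> 0})"

text \<open>There is a polynomial-time algorithm which, on every input satisfying \<open>I\<close>, gives an answer that
  satisfies \<open>A\<close>. One program and one polynomial have to serve all inputs.\<close>

definition poly_time_algorithm ::
    "(nat set \<Rightarrow> nat set set \<Rightarrow> (nat set \<Rightarrow> real) \<Rightarrow> nat set set \<Rightarrow> bool) \<Rightarrow>
     (nat set \<Rightarrow> nat set set \<Rightarrow> (nat set \<Rightarrow> real) \<Rightarrow> nat set set \<Rightarrow> nat set option \<Rightarrow> bool) \<Rightarrow> bool"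
  where
  "poly_time_algorithm I A \<longleftrightarrow>
     (\<exists>(p :: prog) (b :: nat poly). \<forall>n E w M. I {..<n} E w M \<longrightarrow>
        (\<exists>t m. exec p (encode n E w M) t m \<and> t \<le> poly b (n + card E) \<and>
               A {..<n} E w M (decode n m)))"

end

theory Submission
  imports Defs
begin

text \<open>
  Give non-edges weight 0 and let every exposed vertex be its own mate. An arc from \<open>t\<close> to \<open>u\<close> leaves \<open>t\<close>
  through its matching edge and continues to \<open>u\<close>; its weight is \<open>W (mate t) u - W t (mate t)\<close>. By LP
  duality on the bipartite double cover, a set \<open>S\<close> of exposed vertices is an \<open>M\<close>-vertex-stabilizer iff the
  remaining graph has no closed walk of positive weight: such a walk is a direction in which \<open>M\<close> can be
  improved fractionally, and otherwise longest walks provide dual potentials.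

  A closed walk splits at its exposed vertices. Hence, once the closed walks through covered vertices
  are known to be nonpositive, the stabilizers are the sets that contain all exposed vertices on a
  positive closed walk with covered interior (the forced vertices) and hit all pairs of exposed
  vertices joined by a positive walk with covered interior (the conflicts). The longest walks are
  found by the Floyd-Warshall recursion with covered pivots, and taking both ends of conflicts that
  are not yet hit gives the factor 2.

  All vertices of \<open>S\<^sub>1\<close> are forced. A shortest positive walk that forms a conflict between
  unforced vertices turns out to be an augmenting path avoiding \<open>S\<^sub>1\<close>. So if \<open>M\<close> is a maximum-weight
  matching of \<open>G \<setminus> S\<^sub>1\<close>, there are no such conflicts, and the forced vertices alone are
  optimal.
\<close>

section \<open>Walks\<close>

locale stabilizer_problem =
  fixes V :: "'a set" and E :: "'a set set" and w :: "'a set \<Rightarrow> real" and M :: "'a set set"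
  assumes inst: "stabilizer_instance V E w M"
begin

definition W :: "'a \<Rightarrow> 'a \<Rightarrow> real" where
  "W u v = (if {u, v} \<in> E then w {u, v} else 0)"

definition mate :: "'a \<Rightarrow> 'a" where
  "mate v = (if covered M v then THE u. {v, u} \<in> M else v)"

definition arc :: "'a \<Rightarrow> 'a \<Rightarrow> real" where
  "arc t u = W (mate t) u - W t (mate t)"

text \<open>Only the inner vertices are listed. Walks are therefore joined at \<open>k\<close> as
  \<open>us @ k # vs\<close>, a closed walk has \<open>i = j\<close>, and the condition of a covered
  interior concerns \<open>us\<close> alone.\<close>

fun walk_weight :: "'a \<Rightarrow> 'a list \<Rightarrow> 'a \<Rightarrow> real" where
  "walk_weight i [] j = arc i j"
| "walk_weight i (u # us) j = arc i u + walk_weight u us j"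

lemma finite_V: "finite V" and edges_in_V: "e \<in> E \<Longrightarrow> e \<subseteq> V" and card_edge: "e \<in> E \<Longrightarrow> card e = 2"
  and weight_nonneg: "e \<in> E \<Longrightarrow> 0 \<le> w e" and M_subset: "M \<subseteq> E"
  and M_disjoint: "e \<in> M \<Longrightarrow> f \<in> M \<Longrightarrow> v \<in> e \<Longrightarrow> v \<in> f \<Longrightarrow> e = f"
  using inst unfolding stabilizer_instance_def simple_graph_def matching_def by (blast, blast, blast, blast, blast, blast)

lemma finite_E: "finite E"
  using finite_V edges_in_V by (meson Pow_iff finite_Pow_iff finite_subset subsetI)

lemma finite_M: "finite M"
  using finite_E M_subset finite_subset by blast

lemma edgeE:
  assumes "e \<in> E"
  obtains a b where "e = {a, b}" "a \<noteq> b" "a \<in> V" "b \<in> V"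
  using card_edge[OF assms] edges_in_V[OF assms] by (auto simp: card_2_iff)

lemma singleton_not_edge: "{v} \<notin> E"
  using card_edge by fastforce

lemma W_sym: "W u v = W v u"
  by (simp add: W_def insert_commute)

lemma W_nonneg: "0 \<le> W u v"
  by (simp add: W_def weight_nonneg)

lemma W_same [simp]: "W v v = 0"
  using singleton_not_edge by (simp add: W_def)



section \<open>The matching as an involution on the vertices\<close>

lemma coveredI: "{u, v} \<in> M \<Longrightarrow> covered M u" "{u, v} \<in> M \<Longrightarrow> covered M v"
  by (auto simp: covered_def)

lemma covered_in_V: "covered M v \<Longrightarrow> v \<in> V"
  using M_subset edges_in_V by (auto simp: covered_def)

lemma mate_eq:
  assumes "{v, u} \<in> M"
  shows "mate v = u"
proof -
  have "(THE x. {v, x} \<in> M) = u"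
  proof (rule the_equality[where P = "\<lambda>x. {v, x} \<in> M", OF assms])
    fix x assume "{v, x} \<in> M"
    then show "x = u"
      using M_disjoint[of "{v, x}" "{v, u}" v] assms by (auto simp: doubleton_eq_iff)
  qed
  then show ?thesis
    unfolding mate_def using coveredI(1)[OF assms] by simp
qed

lemma mate_edge:
  assumes "covered M v"
  shows "{v, mate v} \<in> M"
proof -
  obtain e where e: "e \<in> M" "v \<in> e"
    using assms by (auto simp: covered_def)
  then obtain u where "e = {v, u}"
    using M_subset edgeE[of e] by (metis insertE insert_commute singletonD subsetD)
  then show ?thesis
    using e mate_eq[of v u] by simp
qed

lemma mate_exposed [simp]: "exposed M v \<Longrightarrow> mate v = v"
  by (simp add: mate_def)

lemma mate_mate [simp]: "mate (mate v) = v"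
  by (cases "covered M v") (auto simp: insert_commute mate_edge intro!: mate_eq)

lemma covered_mate [simp]: "covered M (mate v) \<longleftrightarrow> covered M v"
  by (cases "covered M v") (auto intro: coveredI(2)[OF mate_edge])

lemma mate_neq: "covered M v \<Longrightarrow> mate v \<noteq> v"
  using mate_edge[of v] M_subset singleton_not_edge[of v] by auto

lemma mate_in_V: "v \<in> V \<Longrightarrow> mate v \<in> V"
  by (cases "covered M v") (simp_all add: covered_in_V)

lemma walk_weight_append:
  "walk_weight i (us @ k # vs) j = walk_weight i us k + walk_weight k vs j"
  by (induction us arbitrary: i) auto

text \<open>The reverse of an arc from \<open>t\<close> to \<open>u\<close> is the arc from
  \<open>mate u\<close> to \<open>mate t\<close>. Both use the edge between \<open>mate t\<close>
  and \<open>u\<close>, but each charges the matching edge at its own tail. Along a walk the inner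
  matching edges agree and only those at the two ends have to be corrected.\<close>

lemma walk_weight_reverse:
  "walk_weight i us j + W i (mate i) =
   walk_weight (mate j) (rev (map mate us)) (mate i) + W j (mate j)"
proof (induction us arbitrary: i)
  case Nil
  have "arc i j + W i (mate i) = arc (mate j) (mate i) + W j (mate j)"
    unfolding arc_def mate_mate using W_sym by (metis add.commute add_diff_cancel_left' diff_add_cancel)
  then show ?case
    by simp
next
  case (Cons u us)
  have "arc i u + W i (mate i) = arc (mate u) (mate i) + W u (mate u)"
    unfolding arc_def mate_mate using W_sym by (metis add.commute add_diff_cancel_left' diff_add_cancel)
  moreover have "walk_weight (mate j) (rev (map mate (u # us))) (mate i) =
      walk_weight (mate j) (rev (map mate us)) (mate u) + arc (mate u) (mate i)"
    by (simp add: walk_weight_append)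
  ultimately show ?case
    using Cons[of u] by simp
qed

section \<open>Necessary conditions\<close>

abbreviation remaining :: "'a set \<Rightarrow> 'a set set" where
  "remaining S \<equiv> induced_edges E (V - S)"

lemma finite_remaining: "finite (remaining S)"
  using finite_E by (auto simp: induced_edges_def)

lemma vertex_stabilizer_exposed:
  assumes "vertex_stabilizer V E w M S" "v \<in> S"
  shows "exposed M v"
  using assms by (auto simp: vertex_stabilizer_def max_weight_matching_def matching_def
      induced_edges_def covered_def)

lemma fractional_values_bdd:
  "bdd_above {\<Sum>e\<in>remaining S. w e * x e | x. fractional_matching (V - S) (remaining S) x}"
proof -
  have "(\<Sum>e\<in>remaining S. w e * x e) \<le> (\<Sum>e\<in>remaining S. w e)"
    if x: "fractional_matching (V - S) (remaining S) x" for x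
  proof (rule sum_mono)
    fix e assume e: "e \<in> remaining S"
    then have eE: "e \<in> E" "e \<subseteq> V - S"
      by (auto simp: induced_edges_def)
    then obtain v where v: "v \<in> e" "v \<in> V - S"
      by (metis edgeE insertI1 subsetD)
    have "x e \<le> (\<Sum>e\<in>{e \<in> remaining S. v \<in> e}. x e)"
      using x e v finite_remaining by (intro member_le_sum) (auto simp: fractional_matching_def)
    also have "\<dots> \<le> 1"
      using x v by (auto simp: fractional_matching_def)
    finally show "w e * x e \<le> w e"
      using weight_nonneg[OF eE(1)] by (simp add: mult_left_le)
  qed
  then show ?thesis
    by (auto simp: bdd_above_def)
qed

lemma max_matching_value:
  assumes "max_weight_matching F w N" "finite F"
  shows "Max {sum w N | N. matching F N} = sum w N"
proof (rule Max_eqI)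
  have "{sum w N | N. matching F N} \<subseteq> sum w ` Pow F"
    by (auto simp: matching_def)
  then show "finite {sum w N | N. matching F N}"
    using assms(2) finite_subset by blast
qed (use assms(1) in \<open>auto simp: max_weight_matching_def\<close>)

text \<open>For a small step length, moving from the indicator vector of \<open>M\<close> in
  direction \<open>g\<close> stays in the fractional matching polytope: \<open>g\<close> is negative
  only on \<open>M\<close>, the load of covered vertices does not grow, and exposed vertices have
  slack. Stability makes \<open>M\<close> optimal there, so the direction cannot gain
  weight.\<close>

lemma stabilizer_perturbation:
  fixes g :: "'a set \<Rightarrow> real"
  assumes S: "vertex_stabilizer V E w M S"
    and g_off: "\<And>e. e \<in> remaining S - M \<Longrightarrow> 0 \<le> g e"
    and g_cov: "\<And>v. covered M v \<Longrightarrow> (\<Sum>e\<in>{e \<in> remaining S. v \<in> e}. g e) \<le> 0"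
  shows "(\<Sum>e\<in>remaining S. w e * g e) \<le> 0"
proof -
  let ?F = "remaining S"
  have mx: "max_weight_matching ?F w M" and st: "stable (V - S) ?F w"
    using S by (auto simp: vertex_stabilizer_def)
  have MF: "M \<subseteq> ?F"
    using mx by (simp add: max_weight_matching_def matching_def)
  \<comment> \<open>The reciprocal of \<open>c\<close> is the step length. As \<open>c\<close>
    bounds each entry of \<open>g\<close> and each sum of entries in absolute value,
    \<open>g e / c\<close> is at least -1 on \<open>M\<close> and the load of an exposed vertex
    stays at most 1; the summand 1 makes \<open>c\<close> positive.\<close>
  define c where "c = 1 + (\<Sum>e\<in>?F. \<bar>g e\<bar>)"
  have c: "c > 0"
    unfolding c_def by (smt (verit) sum_nonneg abs_ge_zero)
  have g_c: "\<bar>g e\<bar> \<le> c" if "e \<in> ?F" for e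
    using member_le_sum[of e ?F "\<lambda>e. \<bar>g e\<bar>"] that finite_remaining by (simp add: c_def)
  define x where "x e = of_bool (e \<in> M) + g e / c" for e
  have "fractional_matching (V - S) ?F x"
    unfolding fractional_matching_def
  proof (intro conjI ballI)
    fix e assume e: "e \<in> ?F"
    show "0 \<le> x e"
    proof (cases "e \<in> M")
      case True
      have "- 1 \<le> g e / c"
        using g_c[OF e] c by (simp add: field_simps)
      then show ?thesis
        using True by (simp add: x_def)
    next
      case False
      then show ?thesis
        using g_off[of e] e c by (simp add: x_def)
    qed
  next
    fix v assume v: "v \<in> V - S"
    let ?D = "{e \<in> ?F. v \<in> e}"
    have fin: "finite ?D"
      using finite_remaining by simp
    have split: "sum x ?D = card (?D \<inter> M) + sum g ?D / c"
      using fin by (simp add: x_def sum.distrib sum_divide_distrib of_bool_def sum.If_cases Int_def conj_commute)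
    show "sum x ?D \<le> 1"
    proof (cases "covered M v")
      case True
      have "?D \<inter> M \<subseteq> {{v, mate v}}"
        using M_disjoint mate_edge[OF True] by auto
      then have "card (?D \<inter> M) \<le> 1"
        using card_mono[of "{{v, mate v}}"] by simp
      moreover have "sum g ?D / c \<le> 0"
        using g_cov[OF True] c by (simp add: divide_nonpos_pos)
      ultimately show ?thesis
        unfolding split by linarith
    next
      case False
      then have "?D \<inter> M = {}"
        by (auto simp: covered_def)
      moreover have "sum g ?D \<le> c"
      proof -
        have "sum g ?D \<le> (\<Sum>e\<in>?D. \<bar>g e\<bar>)"
          by (intro sum_mono) auto
        also have "\<dots> \<le> (\<Sum>e\<in>?F. \<bar>g e\<bar>)"
          using finite_remaining by (intro sum_mono2) auto
        finally show ?thesis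
          by (simp add: c_def)
      qed
      ultimately show ?thesis
        unfolding split using c by simp
    qed
  qed
  then have "(\<Sum>e\<in>?F. w e * x e) \<le> Sup {\<Sum>e\<in>?F. w e * x e | x. fractional_matching (V - S) ?F x}"
    by (intro cSup_upper fractional_values_bdd) auto
  also have "\<dots> = sum w M"
    using st max_matching_value[OF mx finite_remaining] by (simp add: stable_def)
  finally have "(\<Sum>e\<in>?F. w e * x e) \<le> sum w M" .
  moreover have "(\<Sum>e\<in>?F. w e * x e) = sum w M + (\<Sum>e\<in>?F. w e * g e) / c"
  proof -
    have "(\<Sum>e\<in>?F. w e * of_bool (e \<in> M)) = sum w M"
      using finite_remaining MF by (simp add: of_bool_def if_distrib sum.If_cases Int_absorb1 cong: if_cong)
    then show ?thesis
      by (simp add: x_def distrib_left sum.distrib sum_divide_distrib)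
  qed
  ultimately show ?thesis
    using c by (simp add: divide_le_0_iff)
qed

section \<open>Walks as directions of fractional improvement\<close>

lemma sum_indicator_edge:
  assumes "finite F"
  shows "(\<Sum>e\<in>F. h e * of_bool (e = c)) = (h c * of_bool (c \<in> F) :: real)"
  using assms by (simp add: of_bool_def if_distrib sum.delta cong: if_cong)

text \<open>An arc moves one unit from the matching edge at \<open>t\<close> to the edge between
  \<open>mate t\<close> and \<open>u\<close>. The changes at \<open>mate t\<close> cancel,
  \<open>t\<close> loses a unit and \<open>u\<close> gains one. An inequality is claimed because the
  second pair may be a non-edge, in which case nothing is gained.\<close>

lemma arc_perturbation:
  assumes S: "\<And>v. covered M v \<Longrightarrow> v \<notin> S" and tu: "t \<in> V - S" "u \<in> V - S"
  shows "\<exists>g. (\<forall>e\<in>remaining S - M. (0::real) \<le> g e) \<and>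
    (\<forall>v. covered M v \<longrightarrow>
      (\<Sum>e\<in>{e \<in> remaining S. v \<in> e}. g e) \<le> of_bool (v = u) - of_bool (v = t)) \<and>
    (\<Sum>e\<in>remaining S. w e * g e) = arc t u"
proof -
  let ?F = "remaining S"
  define g :: "'a set \<Rightarrow> real" where "g e = of_bool (e = {mate t, u}) - of_bool (e = {t, mate t})" for e
  \<comment> \<open>\<open>S\<close> contains exposed vertices only, so a remaining covered vertex
    keeps its mate.\<close>
  have mt: "mate t \<in> V - S"
    using tu S by (metis Diff_iff covered_in_V covered_mate mate_exposed)
  have inF: "{a, b} \<in> ?F \<longleftrightarrow> {a, b} \<in> E" if "a \<in> V - S" "b \<in> V - S" for a b
    using that by (auto simp: induced_edges_def)
  have tM: "{t, mate t} \<in> E \<Longrightarrow> {t, mate t} \<in> M"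
    using mate_edge[of t] singleton_not_edge[of t] by (cases "covered M t") auto
  have "0 \<le> g e" if "e \<in> ?F - M" for e
    using that tM by (auto simp: g_def induced_edges_def)
  moreover have "(\<Sum>e\<in>{e \<in> ?F. v \<in> e}. g e) \<le> of_bool (v = u) - of_bool (v = t)"
    if v: "covered M v" for v
  proof -
    let ?D = "{e \<in> ?F. v \<in> e}"
    have "finite ?D"
      using finite_remaining by simp
    then have "sum g ?D = of_bool ({mate t, u} \<in> ?D) - of_bool ({t, mate t} \<in> ?D)"
      using sum_indicator_edge[of ?D "\<lambda>_. 1"] by (simp add: g_def sum_subtractf)
    also have "\<dots> \<le> of_bool (v = u) - of_bool (v = t)"
    proof (cases "covered M t")
      case True
      then have "{t, mate t} \<in> ?F" "mate t \<noteq> t"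
        using mate_edge[OF True] M_subset inF[OF tu(1) mt] mate_neq by auto
      then show ?thesis by auto
    next
      case False
      then have "mate t = t" "v \<noteq> t" "{t} \<notin> ?F"
        using v singleton_not_edge by (auto simp: induced_edges_def)
      then show ?thesis by auto
    qed
    finally show ?thesis .
  qed
  moreover have "(\<Sum>e\<in>?F. w e * g e) = arc t u"
    using sum_indicator_edge[OF finite_remaining, where h = w] inF mt tu
    by (simp add: g_def right_diff_distrib sum_subtractf arc_def W_def)
  ultimately show ?thesis
    by blast
qed

text \<open>The directions of the arcs are added. The load bounds telescope, since each inner vertex
  gains from the arc that enters it what it loses through the arc that leaves it.\<close>

lemma walk_perturbation:
  assumes S: "\<And>v. covered M v \<Longrightarrow> v \<notin> S" and "i \<in> V - S" "j \<in> V - S" "\<forall>u\<in>set us. covered M u"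
  shows "\<exists>g. (\<forall>e\<in>remaining S - M. (0::real) \<le> g e) \<and>
    (\<forall>v. covered M v \<longrightarrow>
      (\<Sum>e\<in>{e \<in> remaining S. v \<in> e}. g e) \<le> of_bool (v = j) - of_bool (v = i)) \<and>
    (\<Sum>e\<in>remaining S. w e * g e) = walk_weight i us j"
  using assms(2-)
proof (induction us arbitrary: i)
  case Nil
  then show ?case
    using arc_perturbation[OF S] by simp
next
  case (Cons u us)
  have u: "u \<in> V - S"
    using Cons.prems covered_in_V S by auto
  let ?F = "remaining S"
  obtain g where g: "\<forall>e\<in>?F - M. (0::real) \<le> g e"
    "\<And>v. covered M v \<Longrightarrow> (\<Sum>e\<in>{e \<in> ?F. v \<in> e}. g e) \<le> of_bool (v = u) - of_bool (v = i)"
    "(\<Sum>e\<in>?F. w e * g e) = arc i u"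
    using arc_perturbation[OF S Cons.prems(1) u] by blast
  obtain h where h: "\<forall>e\<in>?F - M. (0::real) \<le> h e"
    "\<And>v. covered M v \<Longrightarrow> (\<Sum>e\<in>{e \<in> ?F. v \<in> e}. h e) \<le> of_bool (v = j) - of_bool (v = u)"
    "(\<Sum>e\<in>?F. w e * h e) = walk_weight u us j"
    using Cons.IH[OF u] Cons.prems by auto
  show ?case
    apply (intro exI[of _ "\<lambda>e. g e + h e"] conjI allI impI)
    subgoal using g h by auto
    subgoal for v using g(2)[of v] h(2)[of v] by (simp add: sum.distrib)
    subgoal using g h by (simp add: distrib_left sum.distrib)
    done
qed

text \<open>The load changes sit at the two ends of the walk. They cancel when the walk is closed,
  and at exposed ends the perturbation argument imposes no bound.\<close>

theorem stabilizer_walk_nonpos: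
  assumes S: "vertex_stabilizer V E w M S" and ij: "i \<in> V - S" "j \<in> V - S"
    and us: "\<forall>u\<in>set us. covered M u" and ends: "i = j \<or> exposed M i \<and> exposed M j"
  shows "walk_weight i us j \<le> 0"
proof -
  let ?F = "remaining S"
  obtain g where g: "\<forall>e\<in>?F - M. (0::real) \<le> g e"
    "\<And>v. covered M v \<Longrightarrow> (\<Sum>e\<in>{e \<in> ?F. v \<in> e}. g e) \<le> of_bool (v = j) - of_bool (v = i)"
    "(\<Sum>e\<in>?F. w e * g e) = walk_weight i us j"
    using walk_perturbation[OF _ ij us] vertex_stabilizer_exposed[OF S] by blast
  have "(\<Sum>e\<in>?F. w e * g e) \<le> 0"
  proof (rule stabilizer_perturbation[OF S])
    fix v assume v: "covered M v"
    then show "(\<Sum>e\<in>{e \<in> ?F. v \<in> e}. g e) \<le> 0"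
      using g(2)[OF v] ends by (auto simp: of_bool_def split: if_splits)
  qed (use g in auto)
  then show ?thesis
    using g by simp
qed

end

section \<open>Sufficient conditions\<close>

lemma matching_fractional:
  assumes "matching F N" "finite F"
  shows "fractional_matching U F (\<lambda>e. of_bool (e \<in> N))"
  unfolding fractional_matching_def
proof (intro conjI ballI)
  fix v
  let ?D = "{e \<in> F. v \<in> e}"
  have "(\<Sum>e\<in>?D. of_bool (e \<in> N)) = real (card (?D \<inter> N))"
    using assms(2) by (simp add: of_bool_def sum.If_cases Int_def conj_commute)
  moreover have "card (?D \<inter> N) \<le> Suc 0"
    using assms unfolding matching_def by (intro card_le_Suc0_iff_eq[THEN iffD2]) (simp, blast)
  ultimately show "(\<Sum>e\<in>?D. of_bool (e \<in> N)) \<le> (1::real)"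
    by simp
qed auto

lemma matching_value:
  assumes "matching F N" "finite F"
  shows "(\<Sum>e\<in>F. w e * of_bool (e \<in> N)) = (sum w N :: real)"
proof -
  have "N \<subseteq> F"
    using assms by (simp add: matching_def)
  then show ?thesis
    using assms(2) by (simp add: of_bool_def if_distrib sum.If_cases Int_absorb1 cong: if_cong)
qed

context stabilizer_problem
begin

text \<open>An axiomatic description of a table of longest walks with covered interior, independent
  of how it is computed. Entries are attained by walks, dominate the arcs and satisfy the triangle
  inequality at covered vertices. Nonpositive entries on the covered diagonal rule out walks of
  unbounded weight.\<close>

definition walk_closure :: "('a \<Rightarrow> 'a \<Rightarrow> real) \<Rightarrow> bool" where
  "walk_closure d \<longleftrightarrow>
    (\<forall>i\<in>V. \<forall>j\<in>V. arc i j \<le> d i j \<and> (\<exists>us. (\<forall>u\<in>set us. covered M u) \<and> d i j = walk_weight i us j)) \<and>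
    (\<forall>k. covered M k \<longrightarrow> d k k \<le> 0 \<and> (\<forall>i\<in>V. \<forall>j\<in>V. d i k + d k j \<le> d i j))"

lemma walk_weight_le_closure:
  assumes "walk_closure d" "i \<in> V" "j \<in> V" "\<forall>u\<in>set us. covered M u"
  shows "walk_weight i us j \<le> d i j"
  using assms(2,4)
proof (induction us arbitrary: i)
  case Nil
  then show ?case
    using assms by (simp add: walk_closure_def)
next
  case (Cons u us)
  then have u: "covered M u" "u \<in> V"
    using covered_in_V by auto
  have "walk_weight u us j \<le> d u j" "arc i u \<le> d i u" "d i u + d u j \<le> d i j"
    using Cons u assms(1,3) by (auto simp: walk_closure_def)
  then show ?case
    by simp
qed

text \<open>The potential of a covered vertex is the weight of a longest walk to it from a set of
  sources. The sources are the remaining exposed vertices, and \<open>kept\<close> ensures that the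
  value 0 prescribed at these vertices is compatible with the arcs that enter them.\<close>

lemma potential_exists:
  assumes d: "walk_closure d" and S: "S \<subseteq> V" "\<And>v. v \<in> S \<Longrightarrow> exposed M v"
    and kept: "\<And>x z. \<lbrakk>x \<in> V - S; z \<in> V - S; exposed M x; exposed M z\<rbrakk> \<Longrightarrow> d x z \<le> 0"
  obtains y where "\<And>t u. \<lbrakk>t \<in> V - S; u \<in> V - S\<rbrakk> \<Longrightarrow> y t + arc t u \<le> y u"
    "\<And>x. exposed M x \<Longrightarrow> y x = 0"
proof -
  define X where "X = {x \<in> V - S. exposed M x}"
  \<comment> \<open>If no exposed vertex remains, every remaining vertex serves as a source, so that
    the maximum is still taken over a nonempty set whenever a covered vertex exists.\<close>
  define P where "P = (if X = {} then V - S else X)"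
  define y where "y u = (if covered M u then Max ((\<lambda>p. d p u) ` P) else 0)" for u
  have P: "P \<subseteq> V - S" "finite P"
    using finite_V by (auto simp: P_def X_def)
  have upper: "d p u \<le> y u" if "p \<in> P" "covered M u" for p u
    using that P by (auto simp: y_def)
  have attained: "\<exists>p\<in>P. y u = d p u" if u: "covered M u" for u
  proof -
    have "u \<in> V - S"
      using u covered_in_V S by blast
    then have "P \<noteq> {}"
      by (auto simp: P_def)
    then have "Max ((\<lambda>p. d p u) ` P) \<in> (\<lambda>p. d p u) ` P"
      using P by (intro Max_in) auto
    then show ?thesis
      using u by (auto simp: y_def)
  qed
  have arc_d: "arc t u \<le> d t u" if "t \<in> V - S" "u \<in> V - S" for t u
    using d that by (auto simp: walk_closure_def)
  have triangle: "d i k + d k j \<le> d i j" if "covered M k" "i \<in> V - S" "j \<in> V - S" for i j k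
    using d that by (auto simp: walk_closure_def)
  show ?thesis
  proof (rule that[of y])
    fix t u assume tu: "t \<in> V - S" "u \<in> V - S"
    show "y t + arc t u \<le> y u"
    proof (cases "covered M t")
      case t: True
      then obtain p where p: "p \<in> P" "y t = d p t"
        using attained by blast
      have pu: "y t + arc t u \<le> d p u"
        using triangle[OF t, of p u] arc_d[OF tu] p P tu by auto
      show ?thesis
      proof (cases "covered M u")
        case True
        then show ?thesis
          using pu upper p by force
      next
        case False
        then have "p \<in> X"
          using p tu by (auto simp: P_def X_def split: if_splits)
        then have "d p u \<le> 0"
          using kept[of p u] False tu by (auto simp: X_def)
        then show ?thesis
          using pu False by (simp add: y_def)
      qed
    next
      case t: False
      then have tP: "t \<in> P"
        using tu by (auto simp: P_def X_def)
      show ?thesis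
      proof (cases "covered M u")
        case True
        then show ?thesis
          using upper[OF tP True] arc_d[OF tu] t by (simp add: y_def)
      next
        case False
        then show ?thesis
          using kept[OF tu t False] arc_d[OF tu] t by (simp add: y_def)
      qed
    qed
  qed (simp add: y_def)
qed

text \<open>Complementary slackness: exposed vertices contribute nothing, and grouping the covered
  ones by their matching edges turns the dual objective into the weight of \<open>M\<close>.\<close>

lemma sum_covered_potential:
  fixes \<pi> :: "'a \<Rightarrow> real"
  assumes U: "finite U" "\<And>v. covered M v \<Longrightarrow> v \<in> U"
    and tight: "\<And>u. covered M u \<Longrightarrow> \<pi> u + \<pi> (mate u) = W u (mate u)"
    and zero: "\<And>u. exposed M u \<Longrightarrow> \<pi> u = 0"
  shows "sum \<pi> U = sum w M"
proof -
  have "sum \<pi> U = sum \<pi> (\<Union>M)"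
    using U zero by (intro sum.mono_neutral_right) (auto simp: covered_def)
  also have "\<dots> = (\<Sum>e\<in>M. sum \<pi> e)"
  proof -
    have "finite e" if "e \<in> M" for e
      using that M_subset edges_in_V finite_V by (meson finite_subset subsetD)
    moreover have "e \<inter> f = {}" if "e \<in> M" "f \<in> M" "e \<noteq> f" for e f
      using M_disjoint[OF that(1,2)] that(3) by blast
    ultimately show ?thesis
      using sum.Union_disjoint[of M \<pi>] by simp
  qed
  also have "\<dots> = sum w M"
  proof (rule sum.cong[OF refl])
    fix e assume e: "e \<in> M"
    then obtain a b where ab: "e = {a, b}" "a \<noteq> b"
      using M_subset edgeE by blast
    then have "mate a = b" "covered M a"
      using e mate_eq coveredI by auto
    then show "sum \<pi> e = w e"
      using tight[of a] ab e M_subset by (auto simp: W_def)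
  qed
  finally show ?thesis .
qed

text \<open>The potential \<open>y\<close> and its mirror image \<open>v \<mapsto> W v (mate v) - y (mate v)\<close> form a dual solution on the
  bipartite double cover; their average is a dual solution on the graph.\<close>

theorem stabilizer_of_walk_closure:
  assumes d: "walk_closure d" and S: "S \<subseteq> V" "\<And>v. v \<in> S \<Longrightarrow> exposed M v"
    and kept: "\<And>x z. \<lbrakk>x \<in> V - S; z \<in> V - S; exposed M x; exposed M z\<rbrakk> \<Longrightarrow> d x z \<le> 0"
  shows "vertex_stabilizer V E w M S"
proof -
  let ?F = "remaining S" and ?U = "V - S"
  obtain y where y: "\<And>t u. \<lbrakk>t \<in> ?U; u \<in> ?U\<rbrakk> \<Longrightarrow> y t + arc t u \<le> y u"
    and y0: "\<And>x. exposed M x \<Longrightarrow> y x = 0"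
    using potential_exists[OF d S kept] by blast
  define \<pi> where "\<pi> u = (y u + W u (mate u) - y (mate u)) / 2" for u
  have mateU: "mate u \<in> ?U" if "u \<in> ?U" for u
    using that S by (metis Diff_iff covered_mate mate_exposed mate_in_V)
  \<comment> \<open>This is the potential inequality for the arc from \<open>mate v\<close> to
    \<open>u\<close>.\<close>
  have key: "y (mate v) + W v u \<le> y u + W v (mate v)" if "u \<in> ?U" "v \<in> ?U" for u v
    using y[OF mateU[OF that(2)] that(1)] W_sym[of v "mate v"] by (simp add: arc_def)
  \<comment> \<open>Add \<open>key\<close> for both orders of \<open>u\<close> and \<open>v\<close>
    and halve the sum.\<close>
  have cover: "W u v \<le> \<pi> u + \<pi> v" if "u \<in> ?U" "v \<in> ?U" for u v
    using key[OF that] key[OF that(2,1)] W_sym[of u v] unfolding \<pi>_def by argo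
  \<comment> \<open>Nonnegativity is the case \<open>u = v\<close> of \<open>cover\<close>, because
    \<open>W u u = 0\<close>.\<close>
  have nonneg: "0 \<le> \<pi> u" if "u \<in> ?U" for u
    using cover[OF that that] by simp
  have finU: "finite ?U"
    using finite_V by simp
  have total: "sum \<pi> ?U = sum w M"
  proof (rule sum_covered_potential[OF finU])
    show "v \<in> ?U" if "covered M v" for v
      using that covered_in_V S by blast
    show "\<pi> u + \<pi> (mate u) = W u (mate u)" if "covered M u" for u
      using W_sym[of u "mate u"] unfolding \<pi>_def mate_mate by argo
    show "\<pi> u = 0" if "exposed M u" for u
      using that by (simp add: \<pi>_def)
  qed
  have weak_duality: "(\<Sum>e\<in>?F. w e * x e) \<le> sum w M" if x: "fractional_matching ?U ?F x" for x
  proof -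
    have "(\<Sum>e\<in>?F. w e * x e) \<le> (\<Sum>e\<in>?F. (\<Sum>v\<in>{v \<in> ?U. v \<in> e}. \<pi> v) * x e)"
    proof (rule sum_mono)
      fix e assume e: "e \<in> ?F"
      then have eE: "e \<in> E" "e \<subseteq> ?U"
        by (auto simp: induced_edges_def)
      then obtain a b where ab: "e = {a, b}" "a \<noteq> b"
        using edgeE by blast
      have "{v \<in> ?U. v \<in> e} = {a, b}"
        using eE ab by auto
      then have "w e \<le> (\<Sum>v\<in>{v \<in> ?U. v \<in> e}. \<pi> v)"
        using cover[of a b] eE ab by (simp add: W_def)
      then show "w e * x e \<le> (\<Sum>v\<in>{v \<in> ?U. v \<in> e}. \<pi> v) * x e"
        using x e by (intro mult_right_mono) (auto simp: fractional_matching_def)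
    qed
    also have "\<dots> = (\<Sum>e\<in>?F. \<Sum>v\<in>{v \<in> ?U. v \<in> e}. \<pi> v * x e)"
      by (simp add: sum_distrib_right)
    also have "\<dots> = (\<Sum>v\<in>?U. \<Sum>e\<in>{e \<in> ?F. v \<in> e}. \<pi> v * x e)"
      by (rule sum.swap_restrict[OF finite_remaining finU])
    also have "\<dots> = (\<Sum>v\<in>?U. \<pi> v * (\<Sum>e\<in>{e \<in> ?F. v \<in> e}. x e))"
      by (simp add: sum_distrib_left)
    also have "\<dots> \<le> (\<Sum>v\<in>?U. \<pi> v)"
      using x nonneg by (intro sum_mono) (auto simp: fractional_matching_def mult_left_le)
    finally show ?thesis
      using total by simp
  qed
  have M: "matching ?F M"
  proof -
    have "e \<subseteq> ?U" if "e \<in> M" for e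
      using that S(2) M_subset edges_in_V[of e] unfolding covered_def by blast
    then show ?thesis
      using inst by (auto simp: stabilizer_instance_def matching_def induced_edges_def)
  qed
  have mx: "max_weight_matching ?F w M"
    unfolding max_weight_matching_def
    using M weak_duality[OF matching_fractional] matching_value[of ?F _ w] finite_remaining by simp
  have "Sup {\<Sum>e\<in>?F. w e * x e | x. fractional_matching ?U ?F x} = sum w M"
  proof (rule cSup_eq_maximum)
    show "sum w M \<in> {\<Sum>e\<in>?F. w e * x e | x. fractional_matching ?U ?F x}"
      using matching_fractional[OF M finite_remaining, of ?U] matching_value[OF M finite_remaining, of w]
      by force
  qed (use weak_duality in auto)
  then show ?thesis
    using S mx max_matching_value[OF mx finite_remaining]
    by (simp add: vertex_stabilizer_def stable_def)
qed

end

section \<open>Alternating paths\<close>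

text \<open>The list holds the matching edges crossed on the way from \<open>x\<close> to
  \<open>z\<close>, each oriented in the direction of travel. Disjointness and membership in the
  matching are imposed separately.\<close>

fun chain :: "'a set set \<Rightarrow> 'a \<Rightarrow> ('a \<times> 'a) list \<Rightarrow> 'a \<Rightarrow> bool" where
  "chain F x [] z \<longleftrightarrow> {x, z} \<in> F"
| "chain F x ((a, b) # ps) z \<longleftrightarrow> {x, a} \<in> F \<and> chain F b ps z"

fun chain_weight :: "('a set \<Rightarrow> real) \<Rightarrow> 'a \<Rightarrow> ('a \<times> 'a) list \<Rightarrow> 'a \<Rightarrow> real" where
  "chain_weight w x [] z = w {x, z}"
| "chain_weight w x ((a, b) # ps) z = w {x, a} - w {a, b} + chain_weight w b ps z"

text \<open>Replacing the first matching edge \<open>{a, b}\<close> by \<open>{x, a}\<close> moves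
  the exposed end from \<open>x\<close> to \<open>b\<close>. What is left is a shorter chain for the
  new matching, hence the induction with \<open>N\<close> arbitrary.\<close>

lemma augment_along_chain:
  assumes "matching F N" "finite N" "exposed N x" "exposed N z" "x \<noteq> z"
    "\<forall>(a, b)\<in>set ps. {a, b} \<in> N" "distinct (map fst ps @ map snd ps)" "chain F x ps z"
  shows "\<exists>N'. matching F N' \<and> sum w N' = sum w N + chain_weight w x ps z"
  using assms
proof (induction ps arbitrary: x N)
  case Nil
  have "{x, z} \<notin> N"
    using Nil.prems by (auto simp: covered_def)
  moreover have "matching F (insert {x, z} N)"
    using Nil.prems unfolding matching_def covered_def by auto
  ultimately show ?case
    using Nil.prems(2) by (intro exI[of _ "insert {x, z} N"]) simp
next
  case (Cons p ps)
  obtain a b where p: "p = (a, b)"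
    by force
  have ab: "{a, b} \<in> N" "a \<noteq> b" and xa: "{x, a} \<in> F"
    using Cons.prems p by auto
  have uniq: "e = {a, b}" if "e \<in> N" "a \<in> e \<or> b \<in> e" for e
    using that ab(1) Cons.prems(1)[unfolded matching_def] by (metis disjoint_iff insertCI)
  have neq: "x \<noteq> a" "x \<noteq> b" "z \<noteq> a" "z \<noteq> b"
    using ab Cons.prems(3,4) by (auto simp: covered_def)
  have xaN: "{x, a} \<notin> N"
    using Cons.prems(3) by (auto simp: covered_def)
  let ?N = "insert {x, a} (N - {{a, b}})"
  have 1: "matching F ?N"
    unfolding matching_def
  proof (intro conjI ballI impI)
    show "?N \<subseteq> F"
      using xa Cons.prems(1) by (auto simp: matching_def)
    have disj: "e \<inter> {x, a} = {}" if "e \<in> N - {{a, b}}" for e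
      using that uniq Cons.prems(3) by (auto simp: covered_def)
    show "e \<inter> f = {}" if "e \<in> ?N" "f \<in> ?N" "e \<noteq> f" for e f
      using that disj[of e] disj[of f] Cons.prems(1) unfolding matching_def by (auto simp: Int_commute)
  qed
  have 2: "exposed ?N b"
    unfolding covered_def
  proof
    assume "\<exists>e\<in>?N. b \<in> e"
    then obtain e where e: "e \<in> ?N" "b \<in> e" ..
    then show False
      using neq ab uniq[of e] by auto
  qed
  have 3: "exposed ?N z"
    using neq Cons.prems(4,5) by (auto simp: covered_def)
  have 4: "\<forall>(c, d)\<in>set ps. {c, d} \<in> ?N"
  proof clarify
    fix c d assume cd: "(c, d) \<in> set ps" and "{c, d} \<notin> N - {{a, b}}"
    moreover have "{c, d} \<in> N"
      using cd Cons.prems(6) by auto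
    ultimately have "{c, d} = {a, b}"
      by blast
    moreover have "c \<in> fst ` set ps"
      using cd by force
    ultimately show "{c, d} = {x, a}"
      using Cons.prems(7) p by (auto simp: doubleton_eq_iff)
  qed
  obtain N' where N': "matching F N'" "sum w N' = sum w ?N + chain_weight w b ps z"
    using Cons.IH[OF 1 _ 2 3 _ 4] Cons.prems neq p by auto
  have "sum w ?N = sum w N - w {a, b} + w {x, a}"
    using Cons.prems(2) ab xaN by (simp add: sum_diff1)
  then show ?case
    using N' p by auto
qed

section \<open>Vertex lists of alternating paths and cycles\<close>

lemma walk_edges_simps [simp]:
  "walk_edges [] = []" "walk_edges [a] = []"
  "walk_edges (a # b # vs) = {a, b} # walk_edges (b # vs)"
proof -
  have "[0..<Suc (length vs)] = 0 # map Suc [0..<length vs]"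
    by (metis map_Suc_upt upt_conv_Cons zero_less_Suc)
  then show "walk_edges (a # b # vs) = {a, b} # walk_edges (b # vs)"
    by (simp add: walk_edges_def del: upt_Suc)
qed (simp_all add: walk_edges_def)

lemma length_walk_edges [simp]: "length (walk_edges vs) = length vs - 1"
  by (simp add: walk_edges_def)

lemma walk_edges_snoc: "vs \<noteq> [] \<Longrightarrow> walk_edges (vs @ [v]) = walk_edges vs @ [{last vs, v}]"
proof (induction vs)
  case (Cons a vs)
  then show ?case
    by (cases vs) auto
qed simp

lemma walk_edge_subset: "e \<in> set (walk_edges vs) \<Longrightarrow> e \<subseteq> set vs"
  by (induction vs rule: induct_list012) auto

lemma distinct_walk_edges: "distinct vs \<Longrightarrow> distinct (walk_edges vs)"
  by (induction vs rule: induct_list012) (auto dest: walk_edge_subset)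

lemma cycle_edges_eq: "cs \<noteq> [] \<Longrightarrow> cycle_edges cs = walk_edges cs @ [{last cs, hd cs}]"
  by (simp add: cycle_edges_def walk_edges_snoc)

text \<open>Distinctness permits passing between sums over edge lists and over edge sets. On two
  vertices the closing edge would repeat the only path edge, hence the bound 3.\<close>

lemma distinct_cycle_edges:
  assumes "distinct cs" "length cs \<ge> 3"
  shows "distinct (cycle_edges cs)"
proof -
  obtain a b c l where cs: "cs = a # b # c # l"
    using assms(2) by (metis Suc_le_length_iff numeral_3_eq_3)
  have "last cs = last (c # l)"
    by (simp add: cs)
  then have "last cs \<in> set (c # l)"
    by (simp only: last_in_set list.distinct not_False_eq_True)
  then have "{last cs, a} \<noteq> {a, b}"
    using assms(1) by (auto simp: cs doubleton_eq_iff)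
  moreover have "{last cs, a} \<notin> set (walk_edges (b # c # l))"
    using assms(1) walk_edge_subset[of "{last cs, a}" "b # c # l"] by (auto simp: cs)
  ultimately have "{last cs, a} \<notin> set (walk_edges cs)"
    by (simp add: cs)
  moreover have "cs \<noteq> []" "hd cs = a"
    by (simp_all add: cs)
  ultimately show ?thesis
    using distinct_walk_edges[OF assms(1)] by (simp add: cycle_edges_eq)
qed

text \<open>The flag \<open>b\<close> says whether the first edge belongs to \<open>M\<close>; this
  recursive form replaces conditions on positions.\<close>

fun alternating :: "'a set set \<Rightarrow> 'a set set \<Rightarrow> bool \<Rightarrow> 'a list \<Rightarrow> bool" where
  "alternating E M b (u # v # vs) \<longleftrightarrow>
    {u, v} \<in> E \<and> ({u, v} \<in> M \<longleftrightarrow> b) \<and> alternating E M (\<not> b) (v # vs)"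
| "alternating E M b _ \<longleftrightarrow> True"

lemma alternating_snoc:
  "vs \<noteq> [] \<Longrightarrow> alternating E M b (vs @ [v]) \<longleftrightarrow>
    alternating E M b vs \<and> {last vs, v} \<in> E \<and> ({last vs, v} \<in> M \<longleftrightarrow> b = odd (length vs))"
proof (induction vs arbitrary: b rule: induct_list012)
  case (3 x y zs)
  then show ?case
    using "3.IH"(2)[of "\<not> b"] by auto
qed auto

lemma alternating_of_parity:
  assumes "set (walk_edges vs) \<subseteq> E" "\<And>i. i < length vs - 1 \<Longrightarrow> walk_edges vs ! i \<in> M \<longleftrightarrow> b = even i"
  shows "alternating E M b vs"
  using assms
proof (induction vs arbitrary: b rule: induct_list012)
  case (3 x y zs)
  have "walk_edges (y # zs) ! i \<in> M \<longleftrightarrow> (\<not> b) = even i" if "i < length (y # zs) - 1" for i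
    using "3.prems"(2)[of "Suc i"] that by auto
  then have "alternating E M (\<not> b) (y # zs)"
    using 3 by auto
  then show ?case
    using "3.prems"(1) "3.prems"(2)[of 0] by auto
qed auto

lemma alternating_of_path:
  assumes "set (walk_edges (u # v # vs)) \<subseteq> E"
    "\<And>i. Suc i < length (walk_edges (u # v # vs)) \<Longrightarrow>
      (walk_edges (u # v # vs) ! i \<in> M) \<noteq> (walk_edges (u # v # vs) ! Suc i \<in> M)"
  shows "alternating E M ({u, v} \<in> M) (u # v # vs)"
proof (rule alternating_of_parity[OF assms(1)])
  fix i assume "i < length (u # v # vs) - 1"
  then show "walk_edges (u # v # vs) ! i \<in> M \<longleftrightarrow> ({u, v} \<in> M) = even i"
  proof (induction i)
    case (Suc i)
    then show ?case
      using assms(2)[of i] by auto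
  qed simp
qed

context stabilizer_problem
begin

section \<open>Augmenting paths and flowers as closed walks\<close>

definition signed_weight :: "'a set \<Rightarrow> real" where
  "signed_weight e = (if e \<in> M then - w e else w e)"

lemma sum_signed_weight:
  assumes "distinct es"
  shows "sum_list (map signed_weight es) = sum w (set es - M) - sum w (set es \<inter> M)"
proof -
  have "sum_list (map signed_weight es) = sum signed_weight (set es)"
    using assms by (simp add: sum_list_distinct_conv_sum_set)
  also have "\<dots> = sum signed_weight (set es - M) + sum signed_weight (set es \<inter> M)"
    by (simp add: sum.Int_Diff[of "set es" _ M])
  also have "sum signed_weight (set es - M) = sum w (set es - M)"
    by (intro sum.cong) (auto simp: signed_weight_def)
  also have "sum signed_weight (set es \<inter> M) = - sum w (set es \<inter> M)"
    unfolding sum_negf[symmetric] by (intro sum.cong) (auto simp: signed_weight_def)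
  finally show ?thesis
    by simp
qed

text \<open>A non-matching edge followed by a matching edge is one step of the walk. As an arc first
  crosses the matching edge of its tail, the walk starts at the mate of the first vertex, and the
  last vertex is ready to be left towards any \<open>j\<close>. This free end later closes paths,
  blossoms and stems.\<close>

lemma alternating_walk:
  assumes "odd (length vs)" "alternating E M False vs"
  shows "\<exists>us. (\<forall>u\<in>set us. covered M u) \<and>
    (\<forall>j. walk_weight (mate (hd vs)) us j =
      sum_list (map signed_weight (walk_edges vs)) + W (last vs) j - W (hd vs) (mate (hd vs)))"
  using assms
proof (induction vs rule: length_induct)
  case (1 vs)
  show ?case
  proof (cases "\<exists>a. vs = [a]")
    case True
    then obtain a where "vs = [a]" ..
    then show ?thesis
      using W_sym[of a "mate a"] by (intro exI[of _ "[]"]) (simp add: arc_def)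
  next
    case False
    then obtain a b c l where vs: "vs = a # b # c # l"
      using "1.prems"(1) by (cases vs; cases "tl vs"; cases "tl (tl vs)") auto
    have ab: "{a, b} \<in> E" "{a, b} \<notin> M" and bc: "{b, c} \<in> M" and alt: "alternating E M False (c # l)"
      using "1.prems"(2) by (auto simp: vs)
    have mate: "mate b = c" "mate c = b" "covered M b"
      using mate_eq[OF bc] bc mate_mate[of b] coveredI(1) by auto
    obtain us where us: "\<forall>u\<in>set us. covered M u"
      "\<And>j. walk_weight b us j = sum_list (map signed_weight (walk_edges (c # l))) + W (last (c # l)) j - W c b"
      using "1.IH"[rule_format, of "c # l"] "1.prems"(1) alt mate by (auto simp: vs)
    have "signed_weight {a, b} = W a b" "signed_weight {b, c} = - W b c"
      using ab bc M_subset by (auto simp: signed_weight_def W_def)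
    then have "walk_weight (mate a) (b # us) j = sum_list (map signed_weight (walk_edges vs)) + W (last vs) j - W a (mate a)" for j
      using us(2)[of j] W_sym[of a "mate a"] W_sym[of b c] by (simp add: vs arc_def)
    then show ?thesis
      using us(1) mate(3) by (intro exI[of _ "b # us"]) (simp add: vs)
  qed
qed

text \<open>A flower as a closed walk: along the stem \<open>us\<close>, around the blossom \<open>vs\<close>, and back along the stem.\<close>

lemma flower_weight_le_closure:
  assumes d: "walk_closure d" and x: "x \<in> V" "exposed M x" and u: "covered M u"
    and us: "\<forall>a\<in>set us. covered M a" and vs: "\<forall>a\<in>set vs. covered M a"
  shows "2 * walk_weight x us u + walk_weight u vs (mate u) - W u (mate u) \<le> d x x"
proof -
  let ?walk = "us @ u # vs @ mate u # rev (map mate us)"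
  have "walk_weight x ?walk x \<le> d x x"
    using us vs u x d by (intro walk_weight_le_closure) auto
  moreover have "walk_weight x us u = walk_weight (mate u) (rev (map mate us)) x + W u (mate u)"
    using walk_weight_reverse[of x us u] x by simp
  ultimately show ?thesis
    by (simp add: walk_weight_append)
qed

text \<open>Such a path ends with a matching edge, so the walk along it can return to the exposed
  start. The returning step costs nothing, since \<open>W\<close> is nonnegative and the start has
  no matching edge to charge.\<close>

lemma augmenting_path_closure:
  assumes d: "walk_closure d" and P: "augmenting_path V E w M vs" "exposed M (hd vs)" "covered M (last vs)"
  shows "0 < d (hd vs) (hd vs)"
proof -
  have path: "vs \<noteq> []" "distinct vs" "set vs \<subseteq> V" "set (walk_edges vs) \<subseteq> E"
    "\<And>i. Suc i < length (walk_edges vs) \<Longrightarrow> (walk_edges vs ! i \<in> M) \<noteq> (walk_edges vs ! Suc i \<in> M)"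
    and last: "walk_edges vs \<noteq> []" "last (walk_edges vs) \<in> M"
    and pos: "sum w (set (walk_edges vs) - M) > sum w (set (walk_edges vs) \<inter> M)"
    using P by (auto simp: augmenting_path_def valid_path_def alternating_path_def)
  have "length vs \<ge> 2"
    using last(1) by (cases vs; cases "tl vs") auto
  then obtain a b l where vs: "vs = a # b # l"
    by (metis Suc_le_length_iff numeral_2_eq_2)
  then have "{a, b} \<notin> M"
    using P(2) coveredI by auto
  then have alt: "alternating E M False vs"
    using alternating_of_path[of a b l E M] path by (simp add: vs)
  define zs z where "zs = butlast vs" and "z = last vs"
  have vs': "vs = zs @ [z]" "zs \<noteq> []"
    using path(1) by (simp_all add: zs_def z_def vs)
  have "{last zs, z} \<in> M"
    using last(2) by (simp add: vs' walk_edges_snoc)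
  \<comment> \<open>The first edge lies outside \<open>M\<close> and the last one in
    \<open>M\<close>, so the number of edges is even.\<close>
  then have "odd (length vs)"
    using alt alternating_snoc[OF vs'(2), of E M False z] by (simp add: vs'(1))
  then obtain us where us: "\<forall>u\<in>set us. covered M u" and
    weight: "\<And>j. walk_weight (mate (hd vs)) us j =
      sum_list (map signed_weight (walk_edges vs)) + W (last vs) j - W (hd vs) (mate (hd vs))"
    using alternating_walk[OF _ alt] by blast
  have "0 < sum_list (map signed_weight (walk_edges vs))"
    using sum_signed_weight[OF distinct_walk_edges[OF path(2)]] pos by simp
  also have "\<dots> \<le> walk_weight (hd vs) us (hd vs)"
    using weight[of "hd vs"] P(2) W_nonneg[of "last vs" "hd vs"] by simp
  also have "\<dots> \<le> d (hd vs) (hd vs)"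
    using d us path vs by (intro walk_weight_le_closure) auto
  finally show ?thesis .
qed

text \<open>The blossom is cut open at its base; choosing the base as the free end of
  \<open>alternating_walk\<close> supplies the closing edge. The subtracted term is the matching
  edge at the base, which is 0 when the base is exposed.\<close>

lemma blossom_walk:
  assumes "blossom V E M cs"
  shows "\<exists>us. (\<forall>u\<in>set us. covered M u) \<and>
    walk_weight (mate (hd cs)) us (hd cs) =
      sum w (set (cycle_edges cs) - M) - sum w (set (cycle_edges cs) \<inter> M) - W (hd cs) (mate (hd cs))"
proof -
  have cs: "length cs \<ge> 3" "odd (length cs)" "distinct cs" "set (cycle_edges cs) \<subseteq> E"
    "\<And>i. i < length cs \<Longrightarrow> cycle_edges cs ! i \<in> M \<longleftrightarrow> odd i"
    using assms by (auto simp: blossom_def)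
  have ne: "cs \<noteq> []"
    using cs(1) by auto
  have walk: "walk_edges (cs @ [hd cs]) = cycle_edges cs"
    by (simp add: cycle_edges_def)
  have alt: "alternating E M False (cs @ [hd cs])"
    using cs by (intro alternating_of_parity) (auto simp: walk)
  then have alt': "alternating E M False cs" and close: "{last cs, hd cs} \<in> E" "{last cs, hd cs} \<notin> M"
    using cs(2) by (auto simp: alternating_snoc[OF ne])
  obtain us where us: "\<forall>u\<in>set us. covered M u" and
    weight: "\<And>j. walk_weight (mate (hd cs)) us j =
      sum_list (map signed_weight (walk_edges cs)) + W (last cs) j - W (hd cs) (mate (hd cs))"
    using alternating_walk[OF cs(2) alt'] by blast
  have "sum_list (map signed_weight (cycle_edges cs)) =
      sum_list (map signed_weight (walk_edges cs)) + W (last cs) (hd cs)"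
    using close by (simp add: cycle_edges_eq[OF ne] signed_weight_def W_def)
  then show ?thesis
    using us weight[of "hd cs"] sum_signed_weight[OF distinct_cycle_edges[OF cs(3,1)]] by auto
qed

text \<open>A blossom with exposed base is itself a closed walk at the root. Otherwise the closed
  walk traverses the stem in both directions, which explains the factor 2 in the condition for an
  augmenting flower.\<close>

lemma flower_root_closure:
  assumes d: "walk_closure d" and v: "v \<in> V" "exposed M v" and F: "augmenting_flower_root V E w M v"
  shows "0 < d v v"
  using F unfolding augmenting_flower_root_def
proof (elim disjE exE conjE)
  fix cs assume C: "blossom V E M cs" "hd cs = v"
    and pos: "sum w (set (cycle_edges cs) \<inter> M) < sum w (set (cycle_edges cs) - M)"
  obtain us where us: "\<forall>u\<in>set us. covered M u" "walk_weight (mate v) us v =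
      sum w (set (cycle_edges cs) - M) - sum w (set (cycle_edges cs) \<inter> M) - W v (mate v)"
    using blossom_walk[OF C(1)] C(2) by blast
  have "0 < walk_weight v us v"
    using us(2) pos v by simp
  also have "\<dots> \<le> d v v"
    using d us v by (intro walk_weight_le_closure) auto
  finally show ?thesis .
next
  fix cs vs
  assume C: "blossom V E M cs" and P: "valid_path V E M vs" "2 \<le> length vs" "hd vs = hd cs"
    "{vs ! 0, vs ! 1} \<in> M" "last vs = v"
    and pos: "sum w (set (cycle_edges cs) \<inter> M) + 2 * sum w (set (walk_edges vs) \<inter> M)
      < sum w (set (cycle_edges cs) - M) + 2 * sum w (set (walk_edges vs) - M)"
  obtain b c l where vs: "vs = b # c # l"
    using P(2) by (metis Suc_le_length_iff numeral_2_eq_2)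
  have path: "distinct vs" "set (walk_edges vs) \<subseteq> E"
    "\<And>i. Suc i < length (walk_edges vs) \<Longrightarrow> (walk_edges vs ! i \<in> M) \<noteq> (walk_edges vs ! Suc i \<in> M)"
    using P by (auto simp: valid_path_def alternating_path_def)
  have bc: "{b, c} \<in> M"
    using P(4) by (simp add: vs)
  have mate: "mate b = c" "mate c = b" "covered M b" "covered M c"
    using mate_eq[OF bc] mate_mate[of b] coveredI[OF bc] by auto
  have alt: "alternating E M False (c # l)"
    using alternating_of_path[of b c l E M] path bc by (simp add: vs)
  \<comment> \<open>The root is exposed while \<open>c\<close> is covered, so the stem continues
    beyond its first edge.\<close>
  have "l \<noteq> []"
    using P(5) mate(4) v by (auto simp: vs)
  then obtain zs where zs: "c # l = zs @ [v]" "zs \<noteq> []"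
    using P(5) by (cases l rule: rev_cases) (auto simp: vs)
  have alt': "alternating E M False zs" and end_edge: "{last zs, v} \<in> E"
    and parity: "{last zs, v} \<in> M \<longleftrightarrow> even (length zs)"
    using alt by (auto simp: zs alternating_snoc)
  have nM: "{last zs, v} \<notin> M"
    using v coveredI by auto
  have hd_zs: "hd zs = c"
    using zs by (metis hd_append2 list.sel(1))
  obtain us where us: "\<forall>u\<in>set us. covered M u"
    "walk_weight b us v = sum_list (map signed_weight (walk_edges zs)) + W (last zs) v - W c b"
    using alternating_walk[OF _ alt'] parity nM mate hd_zs by auto
  have "sum_list (map signed_weight (walk_edges vs)) = - W b c + sum_list (map signed_weight (walk_edges (zs @ [v])))"
    using bc subsetD[OF M_subset bc] by (simp add: vs zs(1)[symmetric] signed_weight_def W_def)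
  also have "\<dots> = walk_weight b us v"
    using us(2) nM end_edge W_sym[of b c] by (simp add: walk_edges_snoc[OF zs(2)] signed_weight_def W_def)
  finally have stem: "walk_weight b us v = sum w (set (walk_edges vs) - M) - sum w (set (walk_edges vs) \<inter> M)"
    using sum_signed_weight[OF distinct_walk_edges[OF path(1)]] by simp
  obtain us' where us': "\<forall>u\<in>set us'. covered M u" "walk_weight c us' b =
      sum w (set (cycle_edges cs) - M) - sum w (set (cycle_edges cs) \<inter> M) - W b c"
    using blossom_walk[OF C] P(3) mate by (auto simp: vs)
  \<comment> \<open>The stem was read from the base to the root; reversed, it leads from the root to
    \<open>c\<close>, where the blossom is entered. In the total weight the copies of
    \<open>W b c\<close> cancel.\<close>
  have "walk_weight b us v + W b c = walk_weight v (rev (map mate us)) c"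
    using walk_weight_reverse[of b us v] v mate by simp
  then have "0 < 2 * walk_weight v (rev (map mate us)) c + walk_weight c us' (mate c) - W c (mate c)"
    using us'(2) stem pos mate W_sym[of b c] by simp
  also have "\<dots> \<le> d v v"
    using us us' mate by (intro flower_weight_le_closure[OF d v]) auto
  finally show ?thesis .
qed

theorem S1_closure:
  assumes "walk_closure d" "x \<in> S1 V E w M"
  shows "x \<in> V" "exposed M x" "0 < d x x"
  using assms augmenting_path_closure flower_root_closure by (auto simp: S1_def)

section \<open>No conflicts outside \<open>S1\<close>\<close>

text \<open>Walks may step across non-edges at weight 0. Only those that never do so trace edges of
  the graph.\<close>

fun uses_edges :: "'a \<Rightarrow> 'a list \<Rightarrow> 'a \<Rightarrow> bool" where
  "uses_edges i [] j \<longleftrightarrow> {mate i, j} \<in> E"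
| "uses_edges i (u # us) j \<longleftrightarrow> {mate i, u} \<in> E \<and> uses_edges u us j"

text \<open>Consider a step across a non-edge towards \<open>u\<close>. The rest of the walk from
  \<open>u\<close> to \<open>z\<close> can be closed up at \<open>z\<close> by a step of nonnegative
  weight, so it weighs at most \<open>d z z\<close> and is nonpositive. The part before it can be
  redirected to \<open>x\<close> without loss.\<close>

lemma walk_without_edge:
  assumes d: "walk_closure d" and x: "x \<in> V" and z: "z \<in> V" "exposed M z" "d z z \<le> 0"
    and "i \<in> V" "\<forall>u\<in>set us. covered M u" "\<not> uses_edges i us z"
  shows "walk_weight i us z \<le> d i x"
  using assms(6-)
proof (induction us arbitrary: i)
  case Nil
  then have "walk_weight i [] z \<le> arc i x"
    using W_nonneg[of "mate i" x] by (simp add: arc_def W_def)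
  then show ?case
    using d x Nil(1) by (force simp: walk_closure_def)
next
  case (Cons u us)
  have u: "covered M u" "u \<in> V"
    using Cons.prems covered_in_V by auto
  have arcs: "arc i x \<le> d i x" "arc i u \<le> d i u" "d i u + d u x \<le> d i x"
    using d x u Cons.prems(1) by (auto simp: walk_closure_def)
  show ?case
  proof (cases "{mate i, u} \<in> E")
    case True
    then show ?thesis
      using Cons u arcs by force
  next
    case False
    have "walk_weight z (u # us) z \<le> d z z"
      using d z Cons.prems by (intro walk_weight_le_closure) auto
    then have "walk_weight u us z \<le> 0"
      using z W_nonneg[of z u] by (simp add: arc_def)
    then show ?thesis
      using False arcs(1) W_nonneg[of "mate i" x] by (simp add: arc_def W_def)
  qed
qed

text \<open>A step into \<open>u\<close> continues across the matching edge of \<open>u\<close>, so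
  the pairs of the chain are \<open>(u, mate u)\<close>. For exposed \<open>i\<close> the chain
  starts at \<open>i\<close> itself and the correction term is 0.\<close>

lemma chain_of_walk:
  assumes "\<And>v. covered M v \<Longrightarrow> v \<notin> S" "z \<in> V - S" "i \<in> V - S" "\<forall>u\<in>set us. covered M u" "uses_edges i us z"
  shows "chain (remaining S) (mate i) (map (\<lambda>u. (u, mate u)) us) z \<and>
    chain_weight w (mate i) (map (\<lambda>u. (u, mate u)) us) z = walk_weight i us z + W i (mate i)"
  using assms(3-)
proof (induction us arbitrary: i)
  case Nil
  have "mate i \<in> V - S"
    using Nil assms(1) by (metis Diff_iff covered_mate mate_exposed mate_in_V)
  then show ?case
    using Nil assms(2) W_sym[of i "mate i"] by (auto simp: induced_edges_def arc_def W_def)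
next
  case (Cons u us)
  have u: "covered M u" "u \<in> V - S"
    using Cons.prems assms(1) covered_in_V by auto
  have "mate i \<in> V - S"
    using Cons.prems assms(1) by (metis Diff_iff covered_mate mate_exposed mate_in_V)
  moreover have "w {u, mate u} = W u (mate u)"
    using mate_edge[OF u(1)] M_subset by (auto simp: W_def)
  ultimately show ?case
    using Cons.IH[of u] Cons.prems u by (auto simp: induced_edges_def arc_def W_def insert_commute)
qed

text \<open>In a shortest positive walk between \<open>x\<close> and \<open>z\<close>, a repeated
  vertex could be cut out, and a vertex occurring together with its mate would yield flowers at both
  ends. The walk is therefore a path in the remaining graph, and augmenting along it would beat
  \<open>M\<close>.\<close>

theorem no_conflict:
  assumes d: "walk_closure d"
    and S: "S \<subseteq> {v. exposed M v}" "max_weight_matching (remaining S) w M"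
    and x: "x \<in> V - S" "exposed M x" "d x x \<le> 0" and z: "z \<in> V - S" "exposed M z" "d z z \<le> 0"
  shows "d x z \<le> 0"
proof (rule ccontr)
  assume pos: "\<not> d x z \<le> 0"
  then have neq: "x \<noteq> z"
    using x by auto
  define P where "P us \<longleftrightarrow> (\<forall>u\<in>set us. covered M u) \<and> 0 < walk_weight x us z" for us
  have "\<exists>us. P us"
    using d x(1) z(1) pos unfolding walk_closure_def P_def by (metis DiffD1 not_le)
  then obtain us where us: "P us" and least: "\<And>vs. P vs \<Longrightarrow> length us \<le> length vs"
    using ex_has_least_nat[of P _ length] by blast
  have cov: "\<forall>u\<in>set us. covered M u" and weight: "0 < walk_weight x us z"
    using us by (auto simp: P_def)
  \<comment> \<open>Otherwise the walk would weigh at most \<open>d x x\<close>, which is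
    nonpositive.\<close>
  have "uses_edges x us z"
    using walk_without_edge[OF d _ _ z(2,3), of x x us] x z cov weight by fastforce
  then have chain: "chain (remaining S) x (map (\<lambda>u. (u, mate u)) us) z"
    "chain_weight w x (map (\<lambda>u. (u, mate u)) us) z = walk_weight x us z"
    using chain_of_walk[of S z x us] S(1) x z cov by auto
  have "distinct us"
  proof (rule ccontr)
    assume "\<not> distinct us"
    then obtain p u q r where split: "us = p @ [u] @ q @ [u] @ r"
      using not_distinct_decomp by blast
    have u: "covered M u" "u \<in> V"
      using cov covered_in_V by (auto simp: split)
    \<comment> \<open>The closed part between the two visits of a covered vertex is nonpositive, so
      dropping it leaves a shorter positive walk.\<close>
    have "walk_weight u q u \<le> d u u" "d u u \<le> 0"
      using d u cov walk_weight_le_closure[OF d u(2) u(2), of q] by (auto simp: walk_closure_def split)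
    then have "P (p @ u # r)"
      using cov weight by (auto simp: P_def split walk_weight_append)
    then show False
      using least[of "p @ u # r"] by (simp add: split)
  qed
  moreover have "distinct (map mate us)"
    using \<open>distinct us\<close> by (auto simp: distinct_map inj_on_def dest: arg_cong[of _ _ mate])
  moreover have "set us \<inter> set (map mate us) = {}"
  proof (rule ccontr)
    assume "set us \<inter> set (map mate us) \<noteq> {}"
    then obtain v where v: "v \<in> set us" "mate v \<in> set us"
      by auto
    have "\<exists>a p q r. us = p @ a # q @ mate a # r"
    proof -
      obtain p s where p: "us = p @ v # s"
        using v(1) by (meson split_list)
      have "mate v \<noteq> v"
        using v cov mate_neq by auto
      then consider "mate v \<in> set p" | "mate v \<in> set s"
        using v(2) p by auto
      then show ?thesis
      proof cases
        case 1
        then obtain p1 p2 where "p = p1 @ mate v # p2"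
          by (meson split_list)
        then have "us = p1 @ mate v # p2 @ mate (mate v) # s"
          using p by simp
        then show ?thesis
          by blast
      next
        case 2
        then obtain s1 s2 where "s = s1 @ mate v # s2"
          by (meson split_list)
        then show ?thesis
          using p by blast
      qed
    qed
    then obtain a p q r where split: "us = p @ a # q @ mate a # r"
      by blast
    have a: "covered M a"
      using cov by (auto simp: split)
    \<comment> \<open>The part from \<open>a\<close> to \<open>mate a\<close> serves as the blossom
      of two closed walks, with stem \<open>p\<close> from \<open>x\<close> and stem
      \<open>r\<close>, reversed, from \<open>z\<close>. Their weights add up to exactly twice the
      weight of the whole walk.\<close>
    have "2 * walk_weight x p a + walk_weight a q (mate a) - W a (mate a) \<le> d x x"
      using cov x by (intro flower_weight_le_closure[OF d _ _ a]) (auto simp: split)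
    moreover have "2 * walk_weight z (rev (map mate r)) a + walk_weight a q (mate a) - W a (mate a) \<le> d z z"
      using cov z by (intro flower_weight_le_closure[OF d _ _ a]) (auto simp: split)
    moreover have "walk_weight (mate a) r z + W a (mate a) = walk_weight z (rev (map mate r)) a"
      using walk_weight_reverse[of "mate a" r z] z W_sym[of a "mate a"] by simp
    moreover have "walk_weight x us z = walk_weight x p a + walk_weight a q (mate a) + walk_weight (mate a) r z"
      by (simp add: split walk_weight_append)
    ultimately show False
      using weight x z by linarith
  qed
  ultimately have "distinct (map fst (map (\<lambda>u. (u, mate u)) us) @ map snd (map (\<lambda>u. (u, mate u)) us))"
    by (simp add: comp_def)
  moreover have "matching (remaining S) M"
    using S(2) by (simp add: max_weight_matching_def)
  ultimately obtain N where "matching (remaining S) N" "sum w N = sum w M + walk_weight x us z"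
    using augment_along_chain[OF _ finite_M x(2) z(2) neq _ _ chain(1), of w] cov mate_edge chain(2) by auto
  then show False
    using S(2) weight by (force simp: max_weight_matching_def)
qed

end

section \<open>A small program logic\<close>

text \<open>The only cells below \<open>n * n\<close> known to be free are the diagonal entries of the adjacency matrix.
  Program variables are therefore kept at the addresses \<open>1 + (i + 1) * (n + 1)\<close>, which are diagonal
  entries or lie beyond the matrix. In the absence of multiplication, every program variable
  occupies two such cells, the second one holding \<open>n\<close> times its value, for use as a row offset.
  Variable 0 holds \<open>n\<close>. The mates are stored behind the program variables in the same format, and
  the matrix of walk weights follows the weight matrix.\<close>

record state =
  var :: "nat \<Rightarrow> nat"
  mt :: "nat \<Rightarrow> nat"
  inp :: "nat \<Rightarrow> nat \<Rightarrow> nat"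
  dmat :: "nat \<Rightarrow> nat \<Rightarrow> real"

definition var_addr :: "nat \<Rightarrow> nat \<Rightarrow> nat" where
  "var_addr n i = 1 + (i + 1) * (n + 1)"

text \<open>Five variables use the indices 0 to 9, so index 10 lies behind all of them; the summand
  \<open>n * n\<close> skips the matrix.\<close>

definition mate_addr :: "nat \<Rightarrow> nat \<Rightarrow> nat" where
  "mate_addr n j = n * n + var_addr n 10 + 2 * j"

text \<open>Diagonal entries other than the first are excluded from \<open>inp\<close>, as they may
  hold variables. Row 0 is kept entirely, because its cells 1 to \<open>n\<close> later carry the
  marks of the answer.\<close>

definition represents :: "nat \<Rightarrow> (nat \<Rightarrow> nat \<Rightarrow> real) \<Rightarrow> state \<Rightarrow> memory \<Rightarrow> bool" where
  "represents n W s m \<longleftrightarrow> fst m 0 = n \<and>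
    (\<forall>i<5. fst m (var_addr n (2 * i)) = var s i \<and> fst m (var_addr n (2 * i + 1)) = var s i * n) \<and>
    (\<forall>j<n. fst m (mate_addr n j) = mt s j \<and> fst m (mate_addr n j + 1) = mt s j * n) \<and>
    (\<forall>i<n. \<forall>j<n. i = 0 \<or> i \<noteq> j \<longrightarrow> fst m (1 + i * n + j) = inp s i j) \<and>
    (\<forall>i<n. \<forall>j<n. snd m (n * n + i * n + j) = dmat s i j \<and> snd m (i * n + j) = W i j)"

section \<open>Disjointness of the memory regions\<close>

lemma index_bound:
  assumes "a < n" "b < (n::nat)"
  shows "a * n + b < n * n"
proof -
  have "Suc a * n \<le> n * n"
    using assms(1) by (intro mult_le_mono1) simp
  then show ?thesis
    using assms(2) by simp
qed

lemma index_inject: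
  assumes "b < n" "d < (n::nat)"
  shows "a * n + b = c * n + d \<longleftrightarrow> a = c \<and> b = d"
proof
  assume eq: "a * n + b = c * n + d"
  have "(a * n + b) div n = a" "(c * n + d) div n = c"
    using assms by auto
  then show "a = c \<and> b = d"
    using eq by auto
qed simp

lemma var_addr_inject [simp]: "var_addr n i = var_addr n j \<longleftrightarrow> i = j"
  unfolding var_addr_def add_left_cancel mult_cancel_right by simp

lemma var_addr_pos [simp]: "var_addr n i \<noteq> 0" "0 \<noteq> var_addr n i"
  by (simp_all add: var_addr_def)

text \<open>Inside the matrix the address of variable \<open>i\<close> is row and column
  \<open>i + 1\<close>, a diagonal entry different from the first.\<close>

lemma var_addr_not_matrix:
  assumes "a < n" "b < n" "a = 0 \<or> a \<noteq> b"
  shows "var_addr n i \<noteq> 1 + a * n + b"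
proof
  assume "var_addr n i = 1 + a * n + b"
  then have eq: "(i + 1) * n + (i + 1) = a * n + b"
    by (simp add: var_addr_def algebra_simps)
  show False
  proof (cases "i + 1 < n")
    case True
    then show False
      using index_inject[OF True assms(2), of "i + 1" a] eq assms(3) by auto
  next
    case False
    then have "n * n \<le> (i + 1) * n"
      by (intro mult_le_mono1) simp
    then show False
      using eq index_bound[OF assms(1,2)] by linarith
  qed
qed

lemma var_addr_less_mate: "i < 10 \<Longrightarrow> var_addr n i < mate_addr n j"
proof -
  assume "i < 10"
  then have "(i + 1) * (n + 1) < (10 + 1) * (n + 1)"
    by (intro mult_less_mono1) auto
  then show ?thesis
    by (simp add: mate_addr_def var_addr_def)
qed

lemma matrix_less_mate: "a < n \<Longrightarrow> b < n \<Longrightarrow> 1 + a * n + b < mate_addr n j"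
  using index_bound[of a n b] by (simp add: mate_addr_def var_addr_def)

lemma mate_addr_eq [simp]: "mate_addr n i = mate_addr n j \<longleftrightarrow> i = j"
  "mate_addr n i \<noteq> Suc (mate_addr n j)" "Suc (mate_addr n i) \<noteq> mate_addr n j"
  by (auto simp: mate_addr_def, presburger+)

lemma mate_addr_pos: "0 < mate_addr n j"
  by (simp add: mate_addr_def var_addr_def)

lemma represents_var:
  assumes R: "represents n W s m" and v: "v < 5"
  shows "represents n W (s\<lparr>var := (var s)(v := x)\<rparr>)
    ((fst m)(var_addr n (2 * v) := x, var_addr n (2 * v + 1) := x * n), snd m)"
proof -
  have 1: "2 * v \<noteq> 2 * i + 1" "2 * v + 1 \<noteq> 2 * i" for i
    by presburger+
  have 2: "var_addr n (2 * v) < mate_addr n j" "var_addr n (2 * v + 1) < mate_addr n j" for j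
    using v by (auto intro!: var_addr_less_mate)
  have 3: "mate_addr n j \<noteq> var_addr n (2 * v)" "mate_addr n j \<noteq> var_addr n (2 * v + 1)"
    "mate_addr n j + 1 \<noteq> var_addr n (2 * v)" "mate_addr n j + 1 \<noteq> var_addr n (2 * v + 1)" for j
    using 2[of j] by auto
  have 4: "1 + a * n + b \<noteq> var_addr n i" if "a < n" "b < n" "a = 0 \<or> a \<noteq> b" for a b i
    using var_addr_not_matrix[OF that] by metis
  show ?thesis
    using R 1 3 4 by (simp add: represents_def)
qed

lemma represents_mate:
  assumes R: "represents n W s m" and v: "i < n"
  shows "represents n W (s\<lparr>mt := (mt s)(i := x)\<rparr>)
    ((fst m)(mate_addr n i := x, mate_addr n i + 1 := x * n), snd m)"
proof -
  have 1: "var_addr n j \<noteq> mate_addr n i" "var_addr n j \<noteq> mate_addr n i + 1" if "j < 10" for j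
    using var_addr_less_mate[OF that, of n i] by auto
  have 2: "1 + a * n + b \<noteq> mate_addr n i" "1 + a * n + b \<noteq> mate_addr n i + 1" if "a < n" "b < n" for a b
    using matrix_less_mate[OF that, of i] by auto
  have 3: "0 \<noteq> mate_addr n i"
    using mate_addr_pos[of n i] by simp
  show ?thesis
    using R 1 2 3 by (auto simp: represents_def)
qed

lemma represents_mark:
  assumes R: "represents n W s m" and v: "v < n"
  shows "represents n W (s\<lparr>inp := (inp s)(0 := (inp s 0)(v := x))\<rparr>) ((fst m)(v + 1 := x), snd m)"
proof -
  have n: "0 < n"
    using v by simp
  have 1: "var_addr n j \<noteq> v + 1" for j
    using var_addr_not_matrix[OF n v, of j] by simp
  have 2: "v + 1 < mate_addr n j" for j
    using matrix_less_mate[OF n v, of j] by simp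
  have 3: "mate_addr n j \<noteq> v + 1" "mate_addr n j + 1 \<noteq> v + 1" for j
    using 2[of j] by auto
  have 4: "1 + a * n + b = v + 1 \<longleftrightarrow> a = 0 \<and> b = v" if "a < n" "b < n" for a b
    using index_inject[OF that(2) v, of a 0] by auto
  show ?thesis
    using R 1 3 4 by (simp add: represents_def)
qed

lemma represents_dist:
  assumes R: "represents n W s m" and "i < n" "j < n"
  shows "represents n W (s\<lparr>dmat := (dmat s)(i := (dmat s i)(j := x))\<rparr>)
    (fst m, (snd m)(n * n + i * n + j := x))"
proof -
  have 1: "a * n + b \<noteq> n * n + i * n + j" if "a < n" "b < n" for a b
    using index_bound[OF that] by linarith
  have 2: "n * n + a * n + b = n * n + i * n + j \<longleftrightarrow> a = i \<and> b = j" if "a < n" "b < n" for a b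
    using index_inject[OF that(2) assms(3), of a i] by linarith
  show ?thesis
    using R 1 2 by (simp add: represents_def)
qed

section \<open>Expressions for addresses and values\<close>

fun VarAddr :: "nat \<Rightarrow> nexp" where
  "VarAddr 0 = NPlus (NLoad (NConst 0)) (NConst 2)"
| "VarAddr (Suc i) = NPlus (VarAddr i) (NPlus (NLoad (NConst 0)) (NConst 1))"

definition Val :: "nat \<Rightarrow> nexp" where "Val v = NLoad (VarAddr (2 * v))"
definition Row :: "nat \<Rightarrow> nexp" where "Row v = NLoad (VarAddr (2 * v + 1))"
text \<open>Variable 0 holds \<open>n\<close>, so \<open>Row 0\<close> supplies the product
  \<open>n * n\<close> without a multiplication.\<close>

definition MateAddr :: "nat \<Rightarrow> nexp" where
  "MateAddr v = NPlus (NPlus (Row 0) (VarAddr 10)) (NPlus (Val v) (Val v))"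
definition MateVal :: "nat \<Rightarrow> nexp" where "MateVal v = NLoad (MateAddr v)"
definition MateRow :: "nat \<Rightarrow> nexp" where "MateRow v = NLoad (NPlus (MateAddr v) (NConst 1))"
definition Inp :: "nat \<Rightarrow> nat \<Rightarrow> nexp" where
  "Inp u v = NLoad (NPlus (NPlus (NConst 1) (Row u)) (Val v))"
definition MarkAddr :: "nat \<Rightarrow> nexp" where "MarkAddr v = NPlus (Val v) (NConst 1)"
definition Weight :: "nexp \<Rightarrow> nexp \<Rightarrow> rexp" where "Weight r c = RLoad (NPlus r c)"
definition DistAddr :: "nat \<Rightarrow> nat \<Rightarrow> nexp" where
  "DistAddr u v = NPlus (NPlus (Row 0) (Row u)) (Val v)"
definition Dist :: "nat \<Rightarrow> nat \<Rightarrow> rexp" where "Dist u v = RLoad (DistAddr u v)"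
definition NEq :: "nexp \<Rightarrow> nexp \<Rightarrow> cond" where "NEq a b = Conj (Neg (NLess a b)) (Neg (NLess b a))"

text \<open>The index is a constant of the program, so the product with \<open>n + 1\<close> is
  unrolled into repeated addition.\<close>

lemma nval_VarAddr [simp]: "nval (VarAddr i) m = var_addr (fst m 0) i"
  by (induction i) (simp_all add: var_addr_def)

declare VarAddr.simps [simp del]

lemma cval_NEq [simp]: "cval (NEq a b) m \<longleftrightarrow> nval a m = nval b m"
  by (auto simp: NEq_def)

lemma nval_Val: "represents n W s m \<Longrightarrow> v < 5 \<Longrightarrow> nval (Val v) m = var s v"
  and nval_Row: "represents n W s m \<Longrightarrow> v < 5 \<Longrightarrow> nval (Row v) m = var s v * n"
  by (simp_all add: represents_def Val_def Row_def)

lemma nval_MateAddr: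
  assumes "represents n W s m" "v < 5" "var s 0 = n"
  shows "nval (MateAddr v) m = mate_addr n (var s v)"
proof -
  have "fst m 0 = n"
    using assms by (simp add: represents_def)
  then show ?thesis
    using nval_Val[OF assms(1,2)] nval_Row[OF assms(1), of 0] assms(3)
    by (simp add: MateAddr_def mate_addr_def)
qed

lemma nval_MateVal:
  assumes "represents n W s m" "v < 5" "var s 0 = n" "var s v < n"
  shows "nval (MateVal v) m = mt s (var s v)" "nval (MateRow v) m = mt s (var s v) * n"
  using assms nval_MateAddr[OF assms(1-3)] by (simp_all add: MateVal_def MateRow_def represents_def)

lemma nval_Inp:
  assumes "represents n W s m" "u < 5" "v < 5" "var s u < n" "var s v < n" "var s u \<noteq> var s v"
  shows "nval (Inp u v) m = inp s (var s u) (var s v)"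
  using assms nval_Val[OF assms(1,3)] nval_Row[OF assms(1,2)] by (simp add: Inp_def represents_def)

lemma nval_Mark:
  assumes "represents n W s m" "v < 5" "var s v < n"
  shows "nval (MarkAddr v) m = var s v + 1" "nval (NLoad (MarkAddr v)) m = inp s 0 (var s v)"
proof -
  have "0 < n"
    using assms(3) by simp
  moreover have "\<forall>i<n. \<forall>j<n. i = 0 \<or> i \<noteq> j \<longrightarrow> fst m (1 + i * n + j) = inp s i j"
    using assms(1) unfolding represents_def by (elim conjE)
  ultimately have "fst m (1 + 0 * n + var s v) = inp s 0 (var s v)"
    using assms(3) by blast
  then show "nval (MarkAddr v) m = var s v + 1" "nval (NLoad (MarkAddr v)) m = inp s 0 (var s v)"
    using assms nval_Val[OF assms(1,2)] by (simp_all add: MarkAddr_def)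
qed

lemma rval_Weight:
  assumes "represents n W s m" "nval r m = i * n" "nval c m = j" "i < n" "j < n"
  shows "rval (Weight r c) m = W i j"
  using assms by (simp add: Weight_def represents_def)

lemma nval_DistAddr:
  assumes "represents n W s m" "u < 5" "v < 5" "var s 0 = n"
  shows "nval (DistAddr u v) m = n * n + var s u * n + var s v"
  using nval_Val[OF assms(1,3)] nval_Row[OF assms(1,2)] nval_Row[OF assms(1), of 0] assms(4)
  by (simp add: DistAddr_def)

lemma rval_Dist:
  assumes "represents n W s m" "u < 5" "v < 5" "var s 0 = n" "var s u < n" "var s v < n"
  shows "rval (Dist u v) m = dmat s (var s u) (var s v)"
  using assms nval_DistAddr[OF assms(1-4)] by (simp add: Dist_def represents_def)

section \<open>Hoare triples for total correctness with time bounds\<close>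

definition triple ::
    "nat \<Rightarrow> (nat \<Rightarrow> nat \<Rightarrow> real) \<Rightarrow> (state \<Rightarrow> bool) \<Rightarrow> prog \<Rightarrow> nat \<Rightarrow> (state \<Rightarrow> bool) \<Rightarrow> bool" where
  "triple n W P p T Q \<longleftrightarrow> (\<forall>s m. represents n W s m \<and> P s \<longrightarrow>
    (\<exists>t m' s'. exec p m t m' \<and> t \<le> T \<and> represents n W s' m' \<and> Q s'))"

lemma triple_conseq:
  assumes "triple n W P p T Q" "\<And>s. P' s \<Longrightarrow> P s" "\<And>s. Q s \<Longrightarrow> Q' s" "T \<le> T'"
  shows "triple n W P' p T' Q'"
  using assms unfolding triple_def by (meson le_trans)

text \<open>Freezing the initial state lets a postcondition refer to it.\<close>

lemma triple_fix:
  assumes "\<And>s0. P s0 \<Longrightarrow> triple n W (\<lambda>s. s = s0) p T Q"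
  shows "triple n W P p T Q"
  using assms unfolding triple_def by blast

lemma triple_seq:
  assumes "triple n W P p T Q" "triple n W Q q U R"
  shows "triple n W P (Seq p q) (T + U) R"
  unfolding triple_def
proof (intro allI impI)
  fix s m assume "represents n W s m \<and> P s"
  then obtain t m' s' where 1: "exec p m t m'" "t \<le> T" "represents n W s' m'" "Q s'"
    using assms(1) unfolding triple_def by blast
  then obtain u m'' s'' where 2: "exec q m' u m''" "u \<le> U" "represents n W s'' m''" "R s''"
    using assms(2) unfolding triple_def by blast
  show "\<exists>t m' s'. exec (Seq p q) m t m' \<and> t \<le> T + U \<and> represents n W s' m' \<and> R s'"
    using exec.Seq[OF 1(1) 2(1)] 1(2) 2(2-) add_mono by blast
qed

lemma triple_cond:
  assumes c: "\<And>s m. represents n W s m \<Longrightarrow> P s \<Longrightarrow> cval c m \<longleftrightarrow> b s"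
    and "triple n W (\<lambda>s. P s \<and> b s) p T Q" "triple n W (\<lambda>s. P s \<and> \<not> b s) q T Q"
  shows "triple n W P (Cond c p q) (Suc T) Q"
  unfolding triple_def
proof (intro allI impI)
  fix s m assume s: "represents n W s m \<and> P s"
  show "\<exists>t m' s'. exec (Cond c p q) m t m' \<and> t \<le> Suc T \<and> represents n W s' m' \<and> Q s'"
  proof (cases "b s")
    case True
    then obtain t m' s' where 1: "exec p m t m'" "t \<le> T" "represents n W s' m'" "Q s'"
      using s assms(2) unfolding triple_def by blast
    then show ?thesis
      using exec.CondTrue[of c m p t m' q] c[of s m] s True by (metis Suc_le_mono)
  next
    case False
    then obtain t m' s' where 1: "exec q m t m'" "t \<le> T" "represents n W s' m'" "Q s'"
      using s assms(3) unfolding triple_def by blast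
    then show ?thesis
      using exec.CondFalse[of c m q t m' p] c[of s m] s False by (metis Suc_le_mono)
  qed
qed

lemma triple_skip: "triple n W P Skip 1 P"
  unfolding triple_def using exec.Skip by blast

section \<open>Assignments and counting loops\<close>

definition SetZero :: "nat \<Rightarrow> prog" where
  "SetZero v = Seq (NStore (VarAddr (2 * v)) (NConst 0)) (NStore (VarAddr (2 * v + 1)) (NConst 0))"

definition Incr :: "nat \<Rightarrow> prog" where
  "Incr v = Seq (NStore (VarAddr (2 * v)) (NPlus (Val v) (NConst 1)))
    (NStore (VarAddr (2 * v + 1)) (NPlus (Row v) (NLoad (NConst 0))))"

text \<open>The counter equals \<open>n\<close> on exit. Thus even an empty body is useful:
  \<open>For 0 Skip\<close> puts \<open>n\<close> and \<open>n * n\<close> into the two cells of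
  variable 0.\<close>

definition For :: "nat \<Rightarrow> prog \<Rightarrow> prog" where
  "For v p = Seq (SetZero v) (While (NLess (Val v) (NLoad (NConst 0))) (Seq p (Incr v)))"

definition SetMate :: "nat \<Rightarrow> nat \<Rightarrow> prog" where
  "SetMate u v = Seq (NStore (MateAddr u) (Val v)) (NStore (NPlus (MateAddr u) (NConst 1)) (Row v))"

definition Mark :: "nat \<Rightarrow> nat \<Rightarrow> prog" where
  "Mark v k = NStore (MarkAddr v) (NConst k)"

definition SetDist :: "nat \<Rightarrow> nat \<Rightarrow> rexp \<Rightarrow> prog" where
  "SetDist u v r = RStore (DistAddr u v) r"

lemma exec_two_stores:
  assumes "nval a m = x" "nval b m = y" "m' = ((fst m)(x := y), snd m)" "nval c m' = z" "nval d m' = u"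
  shows "exec (Seq (NStore a b) (NStore c d)) m 2 ((fst m)(x := y, z := u), snd m)"
proof -
  have "exec (NStore a b) m 1 m'"
    using exec.NStore[of a b m] assms by simp
  moreover have "exec (NStore c d) m' 1 ((fst m)(x := y, z := u), snd m)"
    using exec.NStore[of c d m'] assms by simp
  ultimately have "exec (Seq (NStore a b) (NStore c d)) m (1 + 1) ((fst m)(x := y, z := u), snd m)"
    by (rule exec.Seq)
  then show ?thesis
    by (simp add: numeral_2_eq_2)
qed

lemma exec_SetZero:
  assumes "represents n W s m"
  shows "exec (SetZero v) m 2 ((fst m)(var_addr n (2 * v) := 0, var_addr n (2 * v + 1) := 0 * n), snd m)"
  unfolding SetZero_def using assms by (intro exec_two_stores[OF _ _ refl]) (simp_all add: represents_def)

lemma exec_Incr: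
  assumes "represents n W s m" "v < 5"
  shows "exec (Incr v) m 2 ((fst m)(var_addr n (2 * v) := Suc (var s v),
    var_addr n (2 * v + 1) := Suc (var s v) * n), snd m)"
  unfolding Incr_def using assms
  by (intro exec_two_stores[OF _ _ refl]) (simp_all add: represents_def Val_def Row_def)

lemma triple_zero:
  assumes "v < 5"
  shows "triple n W (\<lambda>s. Q (s\<lparr>var := (var s)(v := 0)\<rparr>)) (SetZero v) 2 Q"
  unfolding triple_def
  using exec_SetZero[where v = v] represents_var[OF _ assms, where x = 0] by blast

lemma triple_incr:
  assumes "v < 5"
  shows "triple n W (\<lambda>s. Q (s\<lparr>var := (var s)(v := Suc (var s v))\<rparr>)) (Incr v) 2 Q"
  unfolding triple_def
proof (intro allI impI)
  fix s m assume "represents n W s m \<and> Q (s\<lparr>var := (var s)(v := Suc (var s v))\<rparr>)"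
  then show "\<exists>t m' s'. exec (Incr v) m t m' \<and> t \<le> 2 \<and> represents n W s' m' \<and> Q s'"
    using exec_Incr[of n W s m v] represents_var[of n W s m v "Suc (var s v)"] assms by blast
qed

lemma triple_set_mate:
  assumes "u < 5" "v < 5" "\<And>s. P s \<Longrightarrow> var s 0 = n \<and> var s u < n \<and>
    Q (s\<lparr>mt := (mt s)(var s u := var s v)\<rparr>)"
  shows "triple n W P (SetMate u v) 2 Q"
  unfolding triple_def
proof (intro allI impI)
  fix s m assume s: "represents n W s m \<and> P s"
  let ?i = "var s u" and ?x = "var s v"
  let ?m = "((fst m)(mate_addr n ?i := ?x), snd m)"
  have P: "var s 0 = n" "?i < n" "Q (s\<lparr>mt := (mt s)(?i := ?x)\<rparr>)"
    using s assms(3) by auto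
  have fst0: "fst m 0 = n"
    using s by (simp add: represents_def)
  have neq: "var_addr n k \<noteq> mate_addr n ?i" if "k < 10" for k
    using var_addr_less_mate[OF that, of n ?i] by simp
  \<comment> \<open>The second store is evaluated after the first one has changed the memory, so the
    cells it reads must be shown to be untouched.\<close>
  have same: "nval (Row w) ?m = nval (Row w) m" "nval (Val w) ?m = nval (Val w) m" if "w < 5" for w
    using neq[of "2 * w"] neq[of "2 * w + 1"] that mate_addr_pos[of n ?i] fst0
    by (simp_all add: Row_def Val_def)
  have "nval (MateAddr u) ?m = nval (MateAddr u) m"
    using same[of u] same[of 0] mate_addr_pos[of n ?i] fst0 assms(1) by (simp add: MateAddr_def)
  then have "exec (SetMate u v) m 2 ((fst m)(mate_addr n ?i := ?x, mate_addr n ?i + 1 := ?x * n), snd m)"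
    unfolding SetMate_def
    using nval_MateAddr[of n W s m u] nval_Val[of n W s m v] nval_Row[of n W s m v] s P assms(1,2) same(1)[of v]
    by (intro exec_two_stores[OF _ _ refl]) simp_all
  then show "\<exists>t m' s'. exec (SetMate u v) m t m' \<and> t \<le> 2 \<and> represents n W s' m' \<and> Q s'"
    using represents_mate[of n W s m ?i ?x] s P by blast
qed

lemma triple_mark:
  assumes "v < 5" "\<And>s. P s \<Longrightarrow> var s v < n \<and>
    Q (s\<lparr>inp := (inp s)(0 := (inp s 0)(var s v := k))\<rparr>)"
  shows "triple n W P (Mark v k) 1 Q"
  unfolding triple_def
proof (intro allI impI)
  fix s m assume s: "represents n W s m \<and> P s"
  then have v: "var s v < n"
    using assms(2) by blast
  have "exec (Mark v k) m 1 ((fst m)(var s v + 1 := k), snd m)"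
    using exec.NStore[of "MarkAddr v" "NConst k" m] nval_Mark(1)[of n W s m v] s assms(1) v
    by (simp add: Mark_def)
  then show "\<exists>t m' s'. exec (Mark v k) m t m' \<and> t \<le> 1 \<and> represents n W s' m' \<and> Q s'"
    using represents_mark[of n W s m "var s v" k] s v assms(2) by blast
qed

lemma triple_set_dist:
  assumes "u < 5" "v < 5"
    "\<And>s m. represents n W s m \<Longrightarrow> P s \<Longrightarrow> rval r m = f s"
    "\<And>s. P s \<Longrightarrow> var s 0 = n \<and> var s u < n \<and> var s v < n \<and>
      Q (s\<lparr>dmat := (dmat s)(var s u := (dmat s (var s u))(var s v := f s))\<rparr>)"
  shows "triple n W P (SetDist u v r) 1 Q"
  unfolding triple_def
proof (intro allI impI)
  fix s m assume s: "represents n W s m \<and> P s"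
  then have P: "var s 0 = n" "var s u < n" "var s v < n"
    using assms(4) by blast+
  have "exec (SetDist u v r) m 1 (fst m, (snd m)(n * n + var s u * n + var s v := f s))"
    using exec.RStore[of "DistAddr u v" r m] nval_DistAddr[of n W s m u v] s assms(1,2) P
      assms(3)[of s m] by (simp add: SetDist_def)
  then show "\<exists>t m' s'. exec (SetDist u v r) m t m' \<and> t \<le> 1 \<and> represents n W s' m' \<and> Q s'"
    using represents_dist[of n W s m "var s u" "var s v" "f s"] s P assms(4) by blast
qed

text \<open>Each round costs \<open>T\<close> for the body, 2 for the increment and 1 for the test;
  initialization and the last test cost 3. The body ends with the old counter, so it has to
  establish the invariant for the state after the increment.\<close>

lemma triple_for:
  assumes v: "v < 5"
    and body: "\<And>k. k < n \<Longrightarrow> triple n W (\<lambda>s. I k s \<and> var s v = k) p T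
      (\<lambda>s. I (Suc k) (s\<lparr>var := (var s)(v := Suc k)\<rparr>) \<and> var s v = k)"
    and init: "\<And>s. P s \<Longrightarrow> I 0 (s\<lparr>var := (var s)(v := 0)\<rparr>)"
  shows "triple n W P (For v p) ((T + 3) * n + 3) (\<lambda>s. I n s \<and> var s v = n)"
proof -
  let ?c = "NLess (Val v) (NLoad (NConst 0))" and ?b = "Seq p (Incr v)"
  have loop: "\<exists>t m' s'. exec (While ?c ?b) m t m' \<and> t \<le> (T + 3) * (n - k) + 1 \<and>
      represents n W s' m' \<and> I n s' \<and> var s' v = n"
    if "represents n W s m" "I k s" "var s v = k" "k \<le> n" for k s m
    using that
  proof (induction "n - k" arbitrary: k s m)
    case 0
    then have "k = n" "fst m 0 = n"
      by (auto simp: represents_def)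
    then have "\<not> cval ?c m"
      using nval_Val[OF 0(2) v] 0 by simp
    then have "exec (While ?c ?b) m 1 m"
      by (rule exec.WhileFalse)
    then show ?case
      using 0 \<open>k = n\<close> by (intro exI[of _ 1] exI[of _ m] exI[of _ s]) simp
  next
    case (Suc l)
    then have k: "k < n"
      by simp
    have "fst m 0 = n"
      using Suc by (simp add: represents_def)
    then have c: "cval ?c m"
      using nval_Val[OF Suc(3) v] Suc k by simp
    have "triple n W (\<lambda>s. I k s \<and> var s v = k) ?b (T + 2) (\<lambda>s. I (Suc k) s \<and> var s v = Suc k)"
      by (rule triple_seq[OF body[OF k]], rule triple_conseq[OF triple_incr[OF v]]) auto
    then obtain t m' s' where 1: "exec ?b m t m'" "t \<le> T + 2" "represents n W s' m'"
      "I (Suc k) s'" "var s' v = Suc k"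
      using Suc(3-5) unfolding triple_def by blast
    then obtain u m'' s'' where 2: "exec (While ?c ?b) m' u m''" "u \<le> (T + 3) * (n - Suc k) + 1"
      "represents n W s'' m''" "I n s''" "var s'' v = n"
      using Suc(1)[of "Suc k" s' m'] Suc(2) k by (metis Suc_leI diff_Suc_1 diff_Suc_eq_diff_pred diff_commute)
    have "(T + 3) * (n - k) = (T + 3) * (n - Suc k) + (T + 3)"
      using Suc_diff_Suc[OF k] by (metis add.commute mult_Suc_right)
    then have "Suc (t + u) \<le> (T + 3) * (n - k) + 1"
      using 1(2) 2(2) by linarith
    then show ?case
      using exec.WhileTrue[OF c 1(1) 2(1)] 2 by blast
  qed
  have "triple n W (\<lambda>s. I 0 s \<and> var s v = 0) (While ?c ?b) ((T + 3) * n + 1) (\<lambda>s. I n s \<and> var s v = n)"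
    unfolding triple_def using loop[of _ _ 0] by auto
  from triple_seq[OF triple_zero[OF v] this]
  have "triple n W (\<lambda>s. I 0 (s\<lparr>var := (var s)(v := 0)\<rparr>)) (For v p) ((T + 3) * n + 3) (\<lambda>s. I n s \<and> var s v = n)"
    by (simp add: For_def numeral_3_eq_3)
  then show ?thesis
    by (rule triple_conseq) (use init in auto)
qed

section \<open>The algorithm\<close>

text \<open>Every vertex starts as its own mate. Diagonal entries are ignored because their cells
  may hold variables.\<close>

definition mates_prog :: prog where
  "mates_prog = For 1 (Seq (SetMate 1 1) (For 2
    (Cond (Conj (Neg (NEq (Val 1) (Val 2))) (NLess (NConst 1) (Inp 1 2))) (SetMate 1 2) Skip)))"

definition arcs_prog :: prog where
  "arcs_prog = For 1 (For 2
    (SetDist 1 2 (RMinus (Weight (MateRow 1) (Val 2)) (Weight (Row 1) (MateVal 1)))))"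

text \<open>Variable 4 is a flag: a positive diagonal entry at a covered pivot raises it, and that
  pivot is not relaxed.\<close>

definition closure_prog :: prog where
  "closure_prog = For 3 (Cond (Neg (NEq (MateVal 3) (Val 3)))
    (Cond (RLess (RConst 0) (Dist 3 3))
      (Incr 4)
      (For 1 (For 2 (Cond (RLess (Dist 1 2) (RPlus (Dist 1 3) (Dist 3 2)))
        (SetDist 1 2 (RPlus (Dist 1 3) (Dist 3 2))) Skip))))
    Skip)"

text \<open>The marks overwrite row 0 of the adjacency matrix, whose entries have served their
  purpose once the mates are known; writing 0 is needed to erase old entries.\<close>

definition forced_prog :: prog where
  "forced_prog = For 1 (Cond (RLess (RConst 0) (Dist 1 1)) (Mark 1 1) (Mark 1 0))"

definition cover_prog :: prog where
  "cover_prog = For 1 (For 2 (Cond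
    (Conj (Conj (NEq (MateVal 1) (Val 1)) (NEq (MateVal 2) (Val 2)))
      (Conj (Conj (NEq (NLoad (MarkAddr 1)) (NConst 0)) (NEq (NLoad (MarkAddr 2)) (NConst 0)))
        (RLess (RConst 0) (Dist 1 2))))
    (Seq (Mark 1 1) (Mark 2 1)) Skip))"

text \<open>Cell 0 also supplies \<open>n\<close> to all address computations, so it is overwritten
  only at the very end.\<close>

definition answer_prog :: prog where
  "answer_prog = Cond (NEq (Val 4) (NConst 0)) (NStore (NConst 0) (NConst 1)) (NStore (NConst 0) (NConst 0))"

definition main_prog :: prog where
  "main_prog = Seq (For 0 Skip) (Seq mates_prog (Seq arcs_prog
    (Seq closure_prog (Seq forced_prog cover_prog))))"

section \<open>Initial memory, mates and arcs\<close>

locale nat_stabilizer_problem = stabilizer_problem "{..<n}" E w M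
  for n :: nat and E w M
begin

definition adjacency :: "nat \<Rightarrow> nat \<Rightarrow> nat" where
  "adjacency i j = (if {i, j} \<in> M then 2 else if {i, j} \<in> E then 1 else 0)"

lemma represents_encode:
  "represents n W \<lparr>var = \<lambda>_. 0, mt = \<lambda>_. 0, inp = adjacency, dmat = \<lambda>_ _. 0\<rparr> (encode n E w M)"
proof -
  \<comment> \<open>Diagonal cells are 0 since singletons are not edges; cells beyond the matrix are
    0 by the encoding.\<close>
  have var: "fst (encode n E w M) (var_addr n i) = 0" for i
  proof (cases "i + 1 < n")
    case True
    have "(var_addr n i - 1) = (i + 1) * n + (i + 1)"
      by (simp add: var_addr_def)
    then have "(var_addr n i - 1) div n = i + 1" "(var_addr n i - 1) mod n = i + 1"
      using True by (simp_all only: div_mult_self3 mod_mult_self3) (simp_all add: div_less)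
    then show ?thesis
      using singleton_not_edge[of "i + 1"] M_subset by (auto simp: encode_def Let_def)
  next
    case False
    then have "n * n \<le> (i + 1) * n"
      by (intro mult_le_mono1) simp
    then have "n * n < var_addr n i"
      by (simp add: var_addr_def)
    then show ?thesis
      by (simp add: encode_def)
  qed
  have mates: "fst (encode n E w M) (mate_addr n j) = 0" "fst (encode n E w M) (mate_addr n j + 1) = 0" for j
    by (simp_all add: encode_def mate_addr_def var_addr_def)
  have adj: "fst (encode n E w M) (1 + i * n + j) = adjacency i j" if "i < n" "j < n" for i j
    using index_bound[OF that] that by (simp add: encode_def adjacency_def Let_def)
  have weights: "snd (encode n E w M) (n * n + i * n + j) = 0" "snd (encode n E w M) (i * n + j) = W i j"
    if "i < n" "j < n" for i j
    using index_bound[OF that] that by (simp_all add: encode_def W_def)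
  show ?thesis
    unfolding represents_def using var mates adj weights by (simp add: encode_def)
qed

lemma mate_less: "i < n \<Longrightarrow> mate i < n"
  using mate_in_V by auto

lemma covered_less: "covered M i \<Longrightarrow> i < n"
  using covered_in_V by auto

lemma mate_iff: "i \<noteq> j \<Longrightarrow> {i, j} \<in> M \<longleftrightarrow> mate i = j"
  by (metis mate_edge mate_eq mate_exposed)

lemma triple_mates:
  "triple n W (\<lambda>s. var s 0 = n \<and> var s 4 = 0 \<and> inp s = adjacency) mates_prog ((6 * n + 8) * n + 3)
    (\<lambda>s. var s 0 = n \<and> var s 4 = 0 \<and> (\<forall>i<n. mt s i = mate i))"
proof -
  define I where "I k s \<longleftrightarrow> var s 0 = n \<and> var s 4 = 0 \<and> inp s = adjacency \<and> (\<forall>i<k. mt s i = mate i)" for k and s :: state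
  \<comment> \<open>After columns below \<open>j\<close> have been scanned, the mate of
    \<open>k\<close> is known if it is below \<open>j\<close>; otherwise the default value
    \<open>k\<close> is still in place.\<close>
  define J where "J k j s \<longleftrightarrow> I k s \<and> var s 1 = k \<and> mt s k = (if mate k < j then mate k else k)" for k j and s :: state
  have inner: "triple n W (\<lambda>s. J k j s \<and> var s 2 = j)
     (Cond (Conj (Neg (NEq (Val 1) (Val 2))) (NLess (NConst 1) (Inp 1 2))) (SetMate 1 2) Skip) 3
     (\<lambda>s. J k (Suc j) (s\<lparr>var := (var s)(2 := Suc j)\<rparr>) \<and> var s 2 = j)"
    if k: "k < n" and j: "j < n" for k j
    unfolding numeral_3_eq_3 numeral_2_eq_2[symmetric]
  proof (rule triple_cond[where b = "\<lambda>s. k \<noteq> j \<and> {k, j} \<in> M"])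
    fix s m assume R: "represents n W s m" and s: "J k j s \<and> var s 2 = j"
    have "nval (Val 1) m = k" "nval (Val 2) m = j"
      using nval_Val[OF R] s by (auto simp: J_def)
    moreover have "k \<noteq> j \<Longrightarrow> nval (Inp 1 2) m = adjacency k j"
      using nval_Inp[OF R, of 1 2] s k j by (simp add: J_def I_def)
    ultimately show "cval (Conj (Neg (NEq (Val 1) (Val 2))) (NLess (NConst 1) (Inp 1 2))) m \<longleftrightarrow>
        k \<noteq> j \<and> {k, j} \<in> M"
      by (auto simp: adjacency_def split: if_splits)
  next
    show "triple n W (\<lambda>s. (J k j s \<and> var s 2 = j) \<and> k \<noteq> j \<and> {k, j} \<in> M) (SetMate 1 2) 2
      (\<lambda>s. J k (Suc j) (s\<lparr>var := (var s)(2 := Suc j)\<rparr>) \<and> var s 2 = j)"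
      using k mate_iff by (intro triple_set_mate) (auto simp: J_def I_def)
  next
    show "triple n W (\<lambda>s. (J k j s \<and> var s 2 = j) \<and> \<not> (k \<noteq> j \<and> {k, j} \<in> M)) Skip 2
      (\<lambda>s. J k (Suc j) (s\<lparr>var := (var s)(2 := Suc j)\<rparr>) \<and> var s 2 = j)"
      using mate_iff[of k j] by (intro triple_conseq[OF triple_skip]) (auto simp: J_def I_def less_Suc_eq)
  qed
  have body: "triple n W (\<lambda>s. I k s \<and> var s 1 = k)
     (Seq (SetMate 1 1) (For 2
       (Cond (Conj (Neg (NEq (Val 1) (Val 2))) (NLess (NConst 1) (Inp 1 2))) (SetMate 1 2) Skip)))
     (6 * n + 5) (\<lambda>s. I (Suc k) (s\<lparr>var := (var s)(1 := Suc k)\<rparr>) \<and> var s 1 = k)" if k: "k < n" for k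
  proof -
    have first: "triple n W (\<lambda>s. I k s \<and> var s 1 = k) (SetMate 1 1) 2 (\<lambda>s. I k s \<and> var s 1 = k \<and> mt s k = k)"
      using k by (intro triple_set_mate) (auto simp: I_def)
    have scan: "triple n W (\<lambda>s. I k s \<and> var s 1 = k \<and> mt s k = k) (For 2
       (Cond (Conj (Neg (NEq (Val 1) (Val 2))) (NLess (NConst 1) (Inp 1 2))) (SetMate 1 2) Skip))
       ((3 + 3) * n + 3) (\<lambda>s. J k n s \<and> var s 2 = n)"
      using inner[OF k] by (intro triple_for) (auto simp: J_def I_def)
    show ?thesis
      by (rule triple_conseq[OF triple_seq[OF first scan]])
        (use mate_less[OF k] in \<open>auto simp: J_def I_def less_Suc_eq\<close>)
  qed
  have "triple n W (\<lambda>s. var s 0 = n \<and> var s 4 = 0 \<and> inp s = adjacency) mates_prog ((6 * n + 5 + 3) * n + 3)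
    (\<lambda>s. I n s \<and> var s 1 = n)"
    unfolding mates_prog_def using body by (intro triple_for) (auto simp: I_def)
  then show ?thesis
    by (rule triple_conseq) (auto simp: I_def)
qed

lemma triple_arcs:
  "triple n W (\<lambda>s. var s 0 = n \<and> var s 4 = 0 \<and> (\<forall>i<n. mt s i = mate i)) arcs_prog ((4 * n + 6) * n + 3)
    (\<lambda>s. var s 0 = n \<and> var s 4 = 0 \<and> (\<forall>i<n. mt s i = mate i) \<and> (\<forall>i<n. \<forall>j<n. dmat s i j = arc i j))"
proof -
  define I where "I k j s \<longleftrightarrow> var s 0 = n \<and> var s 4 = 0 \<and> (\<forall>i<n. mt s i = mate i) \<and>
    (\<forall>a<n. \<forall>b<n. a < k \<or> a = k \<and> b < j \<longrightarrow> dmat s a b = arc a b)" for k j and s :: state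
  let ?r = "RMinus (Weight (MateRow 1) (Val 2)) (Weight (Row 1) (MateVal 1))"
  have inner: "triple n W (\<lambda>s. (I k j s \<and> var s 1 = k) \<and> var s 2 = j) (SetDist 1 2 ?r) 1
     (\<lambda>s. (I k (Suc j) (s\<lparr>var := (var s)(2 := Suc j)\<rparr>) \<and> var (s\<lparr>var := (var s)(2 := Suc j)\<rparr>) 1 = k) \<and> var s 2 = j)"
    if k: "k < n" and j: "j < n" for k j
  proof (rule triple_set_dist)
    fix s m assume R: "represents n W s m" and s: "(I k j s \<and> var s 1 = k) \<and> var s 2 = j"
    have 1: "nval (MateRow 1) m = mate k * n" "nval (MateVal 1) m = mate k" "nval (Row 1) m = k * n" "nval (Val 2) m = j"
      using nval_MateVal[OF R, of 1] nval_Row[OF R, of 1] nval_Val[OF R, of 2] s k by (auto simp: I_def)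
    show "rval ?r m = arc k j"
      using rval_Weight[OF R 1(1,4) mate_less[OF k] j] rval_Weight[OF R 1(3,2) k mate_less[OF k]]
      by (simp add: arc_def)
  qed (use k j in \<open>auto simp: I_def less_Suc_eq\<close>)
  have body: "triple n W (\<lambda>s. I k 0 s \<and> var s 1 = k) (For 2 (SetDist 1 2 ?r)) ((1 + 3) * n + 3)
     (\<lambda>s. I (Suc k) 0 (s\<lparr>var := (var s)(1 := Suc k)\<rparr>) \<and> var s 1 = k)" if k: "k < n" for k
  proof -
    have "triple n W (\<lambda>s. I k 0 s \<and> var s 1 = k) (For 2 (SetDist 1 2 ?r)) ((1 + 3) * n + 3)
     (\<lambda>s. (I k n s \<and> var s 1 = k) \<and> var s 2 = n)"
      using inner[OF k] by (intro triple_for[where I = "\<lambda>j s. I k j s \<and> var s 1 = k"]) (auto simp: I_def)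
    then show ?thesis
      by (rule triple_conseq) (auto simp: I_def less_Suc_eq)
  qed
  have "triple n W (\<lambda>s. var s 0 = n \<and> var s 4 = 0 \<and> (\<forall>i<n. mt s i = mate i)) arcs_prog
    (((1 + 3) * n + 3 + 3) * n + 3) (\<lambda>s. I n 0 s \<and> var s 1 = n)"
    unfolding arcs_prog_def using body
    by (intro triple_for[where I = "\<lambda>k s. I k 0 s"]) (auto simp: I_def)
  then show ?thesis
    by (rule triple_conseq) (auto simp: I_def)
qed

section \<open>The Floyd-Warshall recursion with covered pivots\<close>

definition walk_table :: "(nat \<Rightarrow> nat \<Rightarrow> real) \<Rightarrow> bool" where
  "walk_table D \<longleftrightarrow> (\<forall>i<n. \<forall>j<n. \<exists>us. (\<forall>u\<in>set us. covered M u) \<and> D i j = walk_weight i us j)"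

text \<open>The invariant for the pivots processed so far; for \<open>k = n\<close> it combines with
  \<open>walk_table\<close> to give \<open>walk_closure\<close>.\<close>

definition closed_below :: "nat \<Rightarrow> (nat \<Rightarrow> nat \<Rightarrow> real) \<Rightarrow> bool" where
  "closed_below k D \<longleftrightarrow> (\<forall>i<n. \<forall>j<n. arc i j \<le> D i j) \<and>
    (\<forall>p<k. covered M p \<longrightarrow> D p p \<le> 0 \<and> (\<forall>i<n. \<forall>j<n. D i p + D p j \<le> D i j))"

definition relax :: "nat \<Rightarrow> (nat \<Rightarrow> nat \<Rightarrow> real) \<Rightarrow> nat \<Rightarrow> nat \<Rightarrow> real" where
  "relax p D i j = max (D i j) (D i p + D p j)"

definition positive_cycle :: bool where
  "positive_cycle \<longleftrightarrow> (\<exists>k us. covered M k \<and> (\<forall>u\<in>set us. covered M u) \<and> 0 < walk_weight k us k)"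

lemma walk_table_relax:
  assumes "walk_table D" "covered M p"
  shows "walk_table (relax p D)"
  unfolding walk_table_def
proof (intro allI impI)
  fix i j assume ij: "i < n" "j < n"
  obtain us where us: "\<forall>u\<in>set us. covered M u" "D i j = walk_weight i us j"
    using assms ij unfolding walk_table_def by blast
  obtain vs where vs: "\<forall>u\<in>set vs. covered M u" "D i p = walk_weight i vs p"
    using assms ij covered_less unfolding walk_table_def by blast
  obtain ws where ws: "\<forall>u\<in>set ws. covered M u" "D p j = walk_weight p ws j"
    using assms ij covered_less unfolding walk_table_def by blast
  have "D i p + D p j = walk_weight i (vs @ p # ws) j"
    using vs ws by (simp add: walk_weight_append)
  then show "\<exists>us. (\<forall>u\<in>set us. covered M u) \<and> relax p D i j = walk_weight i us j"
    using us vs(1) ws(1) assms(2) unfolding relax_def max_def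
    by (cases "D i j \<le> D i p + D p j") (force intro!: exI[of _ "vs @ p # ws"], force)
qed

lemma closed_below_relax:
  assumes D: "closed_below p D" and p: "covered M p" "D p p \<le> 0"
  shows "closed_below (Suc p) (relax p D)"
proof -
  have pn: "p < n"
    using p covered_less by simp
  have tri: "D i k + D k j \<le> D i j" "D k k \<le> 0" if "k < p" "covered M k" "i < n" "j < n" for i j k
    using D that unfolding closed_below_def by blast+
  have "relax p D k k \<le> 0 \<and> (\<forall>i<n. \<forall>j<n. relax p D i k + relax p D k j \<le> relax p D i j)"
    if k: "k < Suc p" "covered M k" for k
  proof (cases "k = p")
    case True
    then show ?thesis
      using p by (auto simp: relax_def)
  next
    case False
    then have "k < p"
      using k by simp
    note tri = tri[OF this k(2)]
    have kn: "k < n"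
      using k covered_less by simp
    have "D p k + D k p \<le> 0"
      using tri(1)[OF pn pn] p(2) by simp
    then show ?thesis
    proof (intro conjI allI impI)
      show "relax p D k k \<le> 0"
        using \<open>D p k + D k p \<le> 0\<close> tri(2)[OF pn pn] by (simp add: relax_def)
      fix i j assume ij: "i < n" "j < n"
      show "relax p D i k + relax p D k j \<le> relax p D i j"
        using tri(1)[OF ij] tri(1)[OF pn ij(2)] tri(1)[OF ij(1) pn] \<open>D p k + D k p \<le> 0\<close>
        unfolding relax_def by linarith
    qed
  qed
  moreover have "arc i j \<le> relax p D i j" if "i < n" "j < n" for i j
    using D that by (auto simp: closed_below_def relax_def intro: max.coboundedI1)
  ultimately show ?thesis
    by (simp add: closed_below_def)
qed

lemma closed_below_exposed:
  "closed_below k D \<Longrightarrow> exposed M k \<Longrightarrow> closed_below (Suc k) D"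
  by (auto simp: closed_below_def less_Suc_eq)

lemma table_cong:
  assumes "\<And>i j. i < n \<Longrightarrow> j < n \<Longrightarrow> D i j = D' i j"
  shows "walk_table D \<longleftrightarrow> walk_table D'" "closed_below k D \<longleftrightarrow> closed_below k D'"
  using assms covered_less by (auto simp: walk_table_def closed_below_def)

text \<open>The table is updated in place; this is harmless because a nonpositive diagonal entry keeps the row
  and the column of the pivot unchanged.\<close>

lemma triple_relax:
  assumes p: "p < n" "dmat s0 p p \<le> 0" "var s0 0 = n" "var s0 3 = p"
  shows "triple n W (\<lambda>s. s = s0)
    (For 1 (For 2 (Cond (RLess (Dist 1 2) (RPlus (Dist 1 3) (Dist 3 2)))
      (SetDist 1 2 (RPlus (Dist 1 3) (Dist 3 2))) Skip))) ((5 * n + 6) * n + 3)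
    (\<lambda>s. var s 0 = n \<and> mt s = mt s0 \<and> var s 3 = p \<and> var s 4 = var s0 4 \<and>
      (\<forall>i<n. \<forall>j<n. dmat s i j = relax p (dmat s0) i j))"
proof -
  let ?D = "dmat s0"
  define I where "I i j s \<longleftrightarrow> var s 0 = n \<and> mt s = mt s0 \<and> var s 3 = p \<and> var s 4 = var s0 4 \<and>
    (\<forall>a<n. \<forall>b<n. dmat s a b = (if a < i \<or> a = i \<and> b < j then relax p ?D a b else ?D a b))" for i j and s :: state
  have pivot: "relax p ?D a p = ?D a p" "relax p ?D p a = ?D p a" for a
    using p(2) by (simp_all add: relax_def)
  let ?r = "RPlus (Dist 1 3) (Dist 3 2)"
  let ?f = "\<lambda>i j. ?D i p + ?D p j"
  have inner: "triple n W (\<lambda>s. (I i j s \<and> var s 1 = i) \<and> var s 2 = j)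
     (Cond (RLess (Dist 1 2) ?r) (SetDist 1 2 ?r) Skip) 2
     (\<lambda>s. (I i (Suc j) (s\<lparr>var := (var s)(2 := Suc j)\<rparr>) \<and> var (s\<lparr>var := (var s)(2 := Suc j)\<rparr>) 1 = i) \<and> var s 2 = j)"
    if i: "i < n" and j: "j < n" for i j
  proof -
    have r: "rval ?r m = ?f i j" "rval (Dist 1 2) m = ?D i j"
      if R: "represents n W s m" and s: "(I i j s \<and> var s 1 = i) \<and> var s 2 = j" for s m
    proof -
      have "dmat s i p = ?D i p" "dmat s p j = ?D p j" "dmat s i j = ?D i j"
        using s i j p(1) pivot by (auto simp: I_def)
      then show "rval ?r m = ?f i j" "rval (Dist 1 2) m = ?D i j"
        using rval_Dist[OF R, of 1 3] rval_Dist[OF R, of 3 2] rval_Dist[OF R, of 1 2] s i j p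
        by (auto simp: I_def)
    qed
    show ?thesis
      unfolding numeral_2_eq_2[symmetric]
    proof (rule triple_conseq[OF triple_cond[where T = 1 and b = "\<lambda>s. ?D i j < ?f i j"]])
      show "triple n W (\<lambda>s. ((I i j s \<and> var s 1 = i) \<and> var s 2 = j) \<and> ?D i j < ?f i j) (SetDist 1 2 ?r) 1
        (\<lambda>s. (I i (Suc j) (s\<lparr>var := (var s)(2 := Suc j)\<rparr>) \<and> var (s\<lparr>var := (var s)(2 := Suc j)\<rparr>) 1 = i) \<and> var s 2 = j)"
      proof (rule triple_set_dist)
        show "rval ?r m = ?f i j"
          if "represents n W s m" "((I i j s \<and> var s 1 = i) \<and> var s 2 = j) \<and> ?D i j < ?f i j" for s m
          using r that by blast
      qed (use i j in \<open>auto simp: I_def less_Suc_eq relax_def\<close>)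
      show "triple n W (\<lambda>s. ((I i j s \<and> var s 1 = i) \<and> var s 2 = j) \<and> \<not> ?D i j < ?f i j) Skip 1
        (\<lambda>s. (I i (Suc j) (s\<lparr>var := (var s)(2 := Suc j)\<rparr>) \<and> var (s\<lparr>var := (var s)(2 := Suc j)\<rparr>) 1 = i) \<and> var s 2 = j)"
        by (rule triple_conseq[OF triple_skip]) (auto simp: I_def less_Suc_eq relax_def)
    qed (use r in auto)
  qed
  have body: "triple n W (\<lambda>s. I i 0 s \<and> var s 1 = i)
     (For 2 (Cond (RLess (Dist 1 2) ?r) (SetDist 1 2 ?r) Skip)) ((2 + 3) * n + 3)
     (\<lambda>s. I (Suc i) 0 (s\<lparr>var := (var s)(1 := Suc i)\<rparr>) \<and> var s 1 = i)" if i: "i < n" for i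
  proof -
    have "triple n W (\<lambda>s. I i 0 s \<and> var s 1 = i)
      (For 2 (Cond (RLess (Dist 1 2) ?r) (SetDist 1 2 ?r) Skip)) ((2 + 3) * n + 3)
      (\<lambda>s. (I i n s \<and> var s 1 = i) \<and> var s 2 = n)"
      using inner[OF i] by (intro triple_for[where I = "\<lambda>j s. I i j s \<and> var s 1 = i"]) (auto simp: I_def)
    then show ?thesis
      by (rule triple_conseq) (auto simp: I_def less_Suc_eq)
  qed
  have "triple n W (\<lambda>s. s = s0) (For 1 (For 2 (Cond (RLess (Dist 1 2) ?r) (SetDist 1 2 ?r) Skip)))
    (((2 + 3) * n + 3 + 3) * n + 3) (\<lambda>s. I n 0 s \<and> var s 1 = n)"
    using body p by (intro triple_for[where I = "\<lambda>i s. I i 0 s"]) (auto simp: I_def)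
  then show ?thesis
    by (rule triple_conseq) (auto simp: I_def)
qed

lemma triple_closure:
  "triple n W (\<lambda>s. var s 0 = n \<and> var s 4 = 0 \<and> (\<forall>i<n. mt s i = mate i) \<and> (\<forall>i<n. \<forall>j<n. dmat s i j = arc i j))
    closure_prog (((5 * n + 6) * n + 8) * n + 3)
    (\<lambda>s. var s 0 = n \<and> (\<forall>i<n. mt s i = mate i) \<and>
      (if var s 4 = 0 then walk_closure (dmat s) else positive_cycle))"
proof -
  \<comment> \<open>A raised flag only has to certify a positive closed walk through covered
    vertices. The witness comes from \<open>walk_table\<close>, which makes a positive diagonal
    entry the weight of an actual walk.\<close>
  define I where "I k s \<longleftrightarrow> var s 0 = n \<and> (\<forall>i<n. mt s i = mate i) \<and> walk_table (dmat s) \<and>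
    (if var s 4 = 0 then closed_below k (dmat s) else positive_cycle)" for k and s :: state
  let ?relax = "For 1 (For 2 (Cond (RLess (Dist 1 2) (RPlus (Dist 1 3) (Dist 3 2)))
      (SetDist 1 2 (RPlus (Dist 1 3) (Dist 3 2))) Skip))"
  let ?Q = "\<lambda>k s. I (Suc k) (s\<lparr>var := (var s)(3 := Suc k)\<rparr>) \<and> var s 3 = k"
  have pivot: "triple n W (\<lambda>s. (I k s \<and> var s 3 = k) \<and> mate k \<noteq> k)
      (Cond (RLess (RConst 0) (Dist 3 3)) (Incr 4) ?relax) (Suc ((5 * n + 6) * n + 3)) (?Q k)"
    if k: "k < n" for k
  proof (rule triple_cond[where b = "\<lambda>s. 0 < dmat s k k"])
    show "cval (RLess (RConst 0) (Dist 3 3)) m \<longleftrightarrow> 0 < dmat s k k"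
      if "represents n W s m" "(I k s \<and> var s 3 = k) \<and> mate k \<noteq> k" for s m
      using rval_Dist[OF that(1), of 3 3] that(2) k by (simp add: I_def)
    have "?Q k (s\<lparr>var := (var s)(4 := Suc (var s 4))\<rparr>)"
      if s: "((I k s \<and> var s 3 = k) \<and> mate k \<noteq> k) \<and> 0 < dmat s k k" for s
    proof -
      have "covered M k"
        using s mate_exposed by blast
      moreover obtain us where "\<forall>u\<in>set us. covered M u" "dmat s k k = walk_weight k us k"
        using s k unfolding I_def walk_table_def by blast
      ultimately have positive_cycle
        using s unfolding positive_cycle_def by auto
      then show ?thesis
        using s by (simp add: I_def)
    qed
    then show "triple n W (\<lambda>s. ((I k s \<and> var s 3 = k) \<and> mate k \<noteq> k) \<and> 0 < dmat s k k) (Incr 4)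
        ((5 * n + 6) * n + 3) (?Q k)"
      by (intro triple_conseq[OF triple_incr[of 4]]) auto
    show "triple n W (\<lambda>s. ((I k s \<and> var s 3 = k) \<and> mate k \<noteq> k) \<and> \<not> 0 < dmat s k k) ?relax
        ((5 * n + 6) * n + 3) (?Q k)"
    proof (rule triple_fix)
      fix s0 assume s0: "((I k s0 \<and> var s0 3 = k) \<and> mate k \<noteq> k) \<and> \<not> 0 < dmat s0 k k"
      have kcov: "covered M k"
        using s0 mate_exposed by blast
      have relaxed: "walk_table (relax k (dmat s0))"
        "closed_below k (dmat s0) \<Longrightarrow> closed_below (Suc k) (relax k (dmat s0))"
        using s0 walk_table_relax[OF _ kcov] closed_below_relax[OF _ kcov] by (auto simp: I_def)
      have s0': "dmat s0 k k \<le> 0" "var s0 0 = n" "var s0 3 = k"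
        using s0 by (auto simp: I_def)
      show "triple n W (\<lambda>s. s = s0) ?relax ((5 * n + 6) * n + 3) (?Q k)"
      proof (rule triple_conseq[OF triple_relax[OF k s0']])
        fix s :: state assume s: "var s 0 = n \<and> mt s = mt s0 \<and> var s 3 = k \<and> var s 4 = var s0 4 \<and>
          (\<forall>i<n. \<forall>j<n. dmat s i j = relax k (dmat s0) i j)"
        then have "walk_table (dmat s)" "closed_below k (dmat s0) \<Longrightarrow> closed_below (Suc k) (dmat s)"
          using relaxed table_cong[of "dmat s" "relax k (dmat s0)"] by auto
        then show "?Q k s"
          using s s0 by (auto simp: I_def)
      qed auto
    qed
  qed
  have body: "triple n W (\<lambda>s. I k s \<and> var s 3 = k)
     (Cond (Neg (NEq (MateVal 3) (Val 3))) (Cond (RLess (RConst 0) (Dist 3 3)) (Incr 4) ?relax) Skip)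
     (Suc (Suc ((5 * n + 6) * n + 3))) (?Q k)" if k: "k < n" for k
  proof (rule triple_cond[where b = "\<lambda>s. mate k \<noteq> k"])
    show "cval (Neg (NEq (MateVal 3) (Val 3))) m \<longleftrightarrow> mate k \<noteq> k"
      if "represents n W s m" "I k s \<and> var s 3 = k" for s m
      using nval_MateVal[OF that(1), of 3] nval_Val[OF that(1), of 3] that(2) k by (simp add: I_def)
    have "mate k = k \<Longrightarrow> closed_below k D \<Longrightarrow> closed_below (Suc k) D" for D
      using closed_below_exposed mate_neq by blast
    then show "triple n W (\<lambda>s. (I k s \<and> var s 3 = k) \<and> \<not> mate k \<noteq> k) Skip (Suc ((5 * n + 6) * n + 3)) (?Q k)"
      by (intro triple_conseq[OF triple_skip]) (auto simp: I_def)
  qed (rule pivot[OF k])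
  have "triple n W (\<lambda>s. var s 0 = n \<and> var s 4 = 0 \<and> (\<forall>i<n. mt s i = mate i) \<and> (\<forall>i<n. \<forall>j<n. dmat s i j = arc i j))
    closure_prog ((Suc (Suc ((5 * n + 6) * n + 3)) + 3) * n + 3) (\<lambda>s. I n s \<and> var s 3 = n)"
    unfolding closure_prog_def
  proof (rule triple_for[OF _ body])
    fix s :: state assume s: "var s 0 = n \<and> var s 4 = 0 \<and> (\<forall>i<n. mt s i = mate i) \<and> (\<forall>i<n. \<forall>j<n. dmat s i j = arc i j)"
    have "walk_table (dmat s)"
      unfolding walk_table_def using s by (auto intro: exI[of _ "[]"])
    then show "I 0 (s\<lparr>var := (var s)(3 := 0)\<rparr>)"
      using s by (simp add: I_def closed_below_def)
  qed auto
  moreover have "walk_closure D" if "walk_table D" "closed_below n D" for D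
    using that covered_less by (auto simp: walk_table_def closed_below_def walk_closure_def)
  ultimately show ?thesis
    by (elim triple_conseq) (auto simp: I_def algebra_simps)
qed

section \<open>Hitting forced vertices and conflicts\<close>

definition forced :: "(nat \<Rightarrow> nat \<Rightarrow> real) \<Rightarrow> nat set" where
  "forced D = {v. v < n \<and> 0 < D v v}"

definition conflict :: "(nat \<Rightarrow> nat \<Rightarrow> real) \<Rightarrow> nat \<Rightarrow> nat \<Rightarrow> bool" where
  "conflict D x z \<longleftrightarrow> x < n \<and> z < n \<and> exposed M x \<and> exposed M z \<and> 0 < D x z"

definition hits :: "(nat \<Rightarrow> nat \<Rightarrow> real) \<Rightarrow> nat set \<Rightarrow> bool" where
  "hits D T \<longleftrightarrow> forced D \<subseteq> T \<and> (\<forall>x z. conflict D x z \<longrightarrow> x \<in> T \<or> z \<in> T)"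

text \<open>The factor 2 is charged locally, against the part of \<open>T\<close> inside
  \<open>R\<close>, so that it survives each extension by a pair. The last conjunct records that
  pairs are added only if the forced vertices fail to hit some conflict; it yields exact optimality
  in the special case.\<close>

definition thrifty :: "(nat \<Rightarrow> nat \<Rightarrow> real) \<Rightarrow> nat set \<Rightarrow> bool" where
  "thrifty D R \<longleftrightarrow> R \<subseteq> {..<n} \<and> forced D \<subseteq> R \<and> (\<forall>v\<in>R. exposed M v \<or> v \<in> forced D) \<and>
    (\<forall>T. hits D T \<longrightarrow> card R \<le> 2 * card (T \<inter> R)) \<and> (hits D (forced D) \<longrightarrow> R = forced D)"

lemma thrifty_forced: "thrifty D (forced D)"
proof -
  have "T \<inter> forced D = forced D" if "hits D T" for T
    using that by (auto simp: hits_def)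
  then show ?thesis
    by (auto simp: thrifty_def forced_def)
qed

text \<open>The pair is disjoint from \<open>R\<close> and \<open>T\<close> contains one of its
  vertices, so \<open>R\<close> grows by two while the intersection with \<open>T\<close> grows by
  at least one.\<close>

lemma thrifty_insert:
  assumes R: "thrifty D R" and xz: "conflict D x z" "x \<notin> R" "z \<notin> R"
  shows "thrifty D (insert x (insert z R))"
proof -
  have fin: "finite R"
    using R finite_subset by (auto simp: thrifty_def)
  have forced: "forced D \<subseteq> R"
    using R by (simp add: thrifty_def)
  have neq: "x \<noteq> z"
  proof
    assume "x = z"
    then have "x \<in> forced D"
      using xz(1) by (simp add: forced_def conflict_def)
    then show False
      using forced xz(2) by blast
  qed
  have "card (insert x (insert z R)) \<le> 2 * card (T \<inter> insert x (insert z R))" if T: "hits D T" for T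
  proof -
    have "x \<in> T \<or> z \<in> T"
      using T xz(1) by (auto simp: hits_def)
    then obtain y where y: "y \<in> T" "y \<notin> R" "y = x \<or> y = z"
      using xz by auto
    have "card R \<le> 2 * card (T \<inter> R)"
      using R T by (auto simp: thrifty_def)
    moreover have "Suc (card (T \<inter> R)) = card (insert y (T \<inter> R))"
      using fin y(2) by simp
    moreover have "\<dots> \<le> card (T \<inter> insert x (insert z R))"
      using fin y by (intro card_mono) auto
    ultimately show ?thesis
      using fin xz neq by simp
  qed
  moreover have "\<not> hits D (forced D)"
  proof
    assume "hits D (forced D)"
    then have "x \<in> forced D \<or> z \<in> forced D"
      using xz(1) by (simp add: hits_def)
    then show False
      using forced xz(2,3) by blast
  qed
  ultimately show ?thesis
    using R xz(1) by (simp add: thrifty_def conflict_def subset_insertI2)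
qed

definition marked :: "state \<Rightarrow> nat set" where
  "marked s = {v. v < n \<and> inp s 0 v \<noteq> 0}"

lemma marked_var [simp]: "marked (s\<lparr>var := x\<rparr>) = marked s"
  by (simp add: marked_def)

definition frame :: "(nat \<Rightarrow> nat \<Rightarrow> real) \<Rightarrow> nat \<Rightarrow> state \<Rightarrow> bool" where
  "frame D f s \<longleftrightarrow> var s 0 = n \<and> var s 4 = f \<and> (\<forall>i<n. mt s i = mate i) \<and> dmat s = D"

lemma triple_forced:
  "triple n W (frame D f) forced_prog (5 * n + 3) (\<lambda>s. frame D f s \<and> marked s = forced D)"
proof -
  define I where "I k s \<longleftrightarrow> frame D f s \<and> (\<forall>v<k. inp s 0 v = of_bool (0 < D v v))" for k and s :: state
  have body: "triple n W (\<lambda>s. I k s \<and> var s 1 = k) (Cond (RLess (RConst 0) (Dist 1 1)) (Mark 1 1) (Mark 1 0)) (Suc 1)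
     (\<lambda>s. I (Suc k) (s\<lparr>var := (var s)(1 := Suc k)\<rparr>) \<and> var s 1 = k)" if k: "k < n" for k
  proof (rule triple_cond[where b = "\<lambda>s. 0 < D k k"])
    show "cval (RLess (RConst 0) (Dist 1 1)) m \<longleftrightarrow> 0 < D k k"
      if "represents n W s m" "I k s \<and> var s 1 = k" for s m
      using rval_Dist[OF that(1), of 1 1] that(2) k by (simp add: I_def frame_def)
    show "triple n W (\<lambda>s. (I k s \<and> var s 1 = k) \<and> 0 < D k k) (Mark 1 1) 1
      (\<lambda>s. I (Suc k) (s\<lparr>var := (var s)(1 := Suc k)\<rparr>) \<and> var s 1 = k)"
      by (rule triple_mark) (use k in \<open>auto simp: I_def frame_def less_Suc_eq\<close>)
    show "triple n W (\<lambda>s. (I k s \<and> var s 1 = k) \<and> \<not> 0 < D k k) (Mark 1 0) 1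
      (\<lambda>s. I (Suc k) (s\<lparr>var := (var s)(1 := Suc k)\<rparr>) \<and> var s 1 = k)"
      by (rule triple_mark) (use k in \<open>auto simp: I_def frame_def less_Suc_eq\<close>)
  qed
  have "triple n W (frame D f) forced_prog ((Suc 1 + 3) * n + 3) (\<lambda>s. I n s \<and> var s 1 = n)"
    unfolding forced_prog_def using body by (intro triple_for) (auto simp: I_def frame_def)
  then show ?thesis
    by (rule triple_conseq) (auto simp: I_def marked_def forced_def)
qed

lemma triple_cover:
  "triple n W (\<lambda>s. frame D f s \<and> marked s = forced D) cover_prog ((6 * n + 6) * n + 3)
    (\<lambda>s. frame D f s \<and> thrifty D (marked s) \<and> hits D (marked s))"
proof -
  define I where "I i j s \<longleftrightarrow> frame D f s \<and> thrifty D (marked s) \<and>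
    (\<forall>x z. conflict D x z \<and> (x < i \<or> x = i \<and> z < j) \<longrightarrow> x \<in> marked s \<or> z \<in> marked s)" for i j and s :: state
  let ?c = "Conj (Conj (NEq (MateVal 1) (Val 1)) (NEq (MateVal 2) (Val 2)))
      (Conj (Conj (NEq (NLoad (MarkAddr 1)) (NConst 0)) (NEq (NLoad (MarkAddr 2)) (NConst 0)))
        (RLess (RConst 0) (Dist 1 2)))"
  let ?body = "Cond ?c (Seq (Mark 1 1) (Mark 2 1)) Skip"
  have mate_exposed_iff: "mate i = i \<longleftrightarrow> exposed M i" for i
    using mate_neq by auto
  have inner: "triple n W (\<lambda>s. (I i j s \<and> var s 1 = i) \<and> var s 2 = j) ?body (Suc (1 + 1))
     (\<lambda>s. (I i (Suc j) (s\<lparr>var := (var s)(2 := Suc j)\<rparr>) \<and> var (s\<lparr>var := (var s)(2 := Suc j)\<rparr>) 1 = i) \<and> var s 2 = j)"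
    (is "triple n W ?P ?body _ ?Q")
    if i: "i < n" and j: "j < n" for i j
  proof (rule triple_cond[where b = "\<lambda>s. conflict D i j \<and> i \<notin> marked s \<and> j \<notin> marked s"])
    fix s m assume R: "represents n W s m" and s: "?P s"
    have vars: "var s 0 = n" "var s 1 = i" "var s 2 = j" "mt s i = mate i" "mt s j = mate j" "dmat s = D"
      using s i j by (auto simp: I_def frame_def)
    have vals: "nval (MateVal 1) m = mate i" "nval (MateVal 2) m = mate j" "nval (Val 1) m = i"
      "nval (Val 2) m = j" "nval (NLoad (MarkAddr 1)) m = inp s 0 i" "nval (NLoad (MarkAddr 2)) m = inp s 0 j"
      "rval (Dist 1 2) m = D i j"
      using vars i j nval_MateVal(1)[OF R, of 1] nval_MateVal(1)[OF R, of 2] nval_Val[OF R, of 1]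
        nval_Val[OF R, of 2] nval_Mark(2)[OF R, of 1] nval_Mark(2)[OF R, of 2] rval_Dist[OF R, of 1 2]
      by simp_all
    show "cval ?c m \<longleftrightarrow> conflict D i j \<and> i \<notin> marked s \<and> j \<notin> marked s"
      unfolding cval.simps cval_NEq vals rval.simps nval.simps(1)
      using i j mate_exposed_iff by (auto simp: conflict_def marked_def)
  next
    let ?A = "\<lambda>s. ?P s \<and> conflict D i j \<and> i \<notin> marked s \<and> j \<notin> marked s"
    have step: "?Q (s'\<lparr>inp := (inp s')(0 := (inp s' 0)(j := 1))\<rparr>)"
      if s: "?A s" and s': "s' = s\<lparr>inp := (inp s)(0 := (inp s 0)(i := 1))\<rparr>" for s s'
    proof -
      have m: "marked (s'\<lparr>inp := (inp s')(0 := (inp s' 0)(j := 1)), var := (var s')(2 := Suc j)\<rparr>) = insert i (insert j (marked s))"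
        using i j by (auto simp: marked_def s')
      have "thrifty D (insert i (insert j (marked s)))"
        using s thrifty_insert by (simp add: I_def)
      then show ?thesis
        using s m by (auto simp: I_def frame_def less_Suc_eq s')
    qed
    show "triple n W ?A (Seq (Mark 1 1) (Mark 2 1)) (1 + 1) ?Q"
    proof (rule triple_seq)
      \<comment> \<open>Between the two marks the invariant may fail, so the intermediate assertion
        remembers the state before the first one.\<close>
      show "triple n W ?A (Mark 1 1) 1 (\<lambda>s'. \<exists>s. ?A s \<and> s' = s\<lparr>inp := (inp s)(0 := (inp s 0)(i := 1))\<rparr>)"
        using i by (intro triple_mark) auto
      show "triple n W (\<lambda>s'. \<exists>s. ?A s \<and> s' = s\<lparr>inp := (inp s)(0 := (inp s 0)(i := 1))\<rparr>) (Mark 2 1) 1 ?Q"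
      proof (rule triple_mark)
        fix s' assume "\<exists>s. ?A s \<and> s' = s\<lparr>inp := (inp s)(0 := (inp s 0)(i := 1))\<rparr>"
        then obtain s where s: "?A s" "s' = s\<lparr>inp := (inp s)(0 := (inp s 0)(i := 1))\<rparr>"
          by blast
        have "var s' 2 = j"
          using s by simp
        then show "var s' 2 < n \<and> ?Q (s'\<lparr>inp := (inp s')(0 := (inp s' 0)(var s' 2 := 1))\<rparr>)"
          using step[OF s] j by presburger
      qed simp
    qed
  next
    show "triple n W (\<lambda>s. ?P s \<and> \<not> (conflict D i j \<and> i \<notin> marked s \<and> j \<notin> marked s)) Skip (1 + 1) ?Q"
      by (rule triple_conseq[OF triple_skip]) (auto simp: I_def frame_def less_Suc_eq)
  qed
  have body: "triple n W (\<lambda>s. I i 0 s \<and> var s 1 = i) (For 2 ?body) ((Suc (1 + 1) + 3) * n + 3)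
     (\<lambda>s. I (Suc i) 0 (s\<lparr>var := (var s)(1 := Suc i)\<rparr>) \<and> var s 1 = i)" if i: "i < n" for i
  proof -
    have "triple n W (\<lambda>s. I i 0 s \<and> var s 1 = i) (For 2 ?body) ((Suc (1 + 1) + 3) * n + 3)
     (\<lambda>s. (I i n s \<and> var s 1 = i) \<and> var s 2 = n)"
      using inner[OF i] by (intro triple_for[where I = "\<lambda>j s. I i j s \<and> var s 1 = i"])
        (auto simp: I_def frame_def)
    then show ?thesis
      by (rule triple_conseq) (auto simp: I_def frame_def less_Suc_eq conflict_def)
  qed
  have "triple n W (\<lambda>s. frame D f s \<and> marked s = forced D) cover_prog
    (((Suc (1 + 1) + 3) * n + 3 + 3) * n + 3) (\<lambda>s. I n 0 s \<and> var s 1 = n)"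
    unfolding cover_prog_def
  proof (rule triple_for[where I = "\<lambda>i s. I i 0 s", OF _ body])
    fix s assume s: "frame D f s \<and> marked s = forced D"
    then show "I 0 0 (s\<lparr>var := (var s)(1 := 0)\<rparr>)"
      using s thrifty_forced by (simp add: I_def frame_def)
  qed auto
  moreover have "hits D (marked s)" if "I n 0 s" for s
  proof -
    have "forced D \<subseteq> marked s"
      using that by (simp add: I_def thrifty_def)
    moreover have "x \<in> marked s \<or> z \<in> marked s" if "conflict D x z" for x z
    proof -
      have "x < n"
        using that by (simp add: conflict_def)
      then show ?thesis
        using \<open>I n 0 s\<close> that unfolding I_def by blast
    qed
    ultimately show ?thesis
      by (simp add: hits_def)
  qed
  ultimately show ?thesis
    by (elim triple_conseq) (auto simp: I_def)
qed

lemma triple_main: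
  "triple n W (\<lambda>s. var s = (\<lambda>_. 0) \<and> inp s = adjacency) main_prog (50 * (n + 1) ^ 3)
    (\<lambda>s. if var s 4 = 0
      then \<exists>D. walk_closure D \<and> thrifty D (marked s) \<and> hits D (marked s) else positive_cycle)"
proof -
  have cover: "triple n W (\<lambda>s. var s 0 = n \<and> (\<forall>i<n. mt s i = mate i) \<and>
      (if var s 4 = 0 then walk_closure (dmat s) else positive_cycle))
    (Seq forced_prog cover_prog) (5 * n + 3 + ((6 * n + 6) * n + 3))
    (\<lambda>s. if var s 4 = 0
      then \<exists>D. walk_closure D \<and> thrifty D (marked s) \<and> hits D (marked s) else positive_cycle)"
  proof (rule triple_fix)
    fix s0 :: state assume s0: "var s0 0 = n \<and> (\<forall>i<n. mt s0 i = mate i) \<and>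
      (if var s0 4 = 0 then walk_closure (dmat s0) else positive_cycle)"
    show "triple n W (\<lambda>s. s = s0) (Seq forced_prog cover_prog) (5 * n + 3 + ((6 * n + 6) * n + 3))
      (\<lambda>s. if var s 4 = 0
        then \<exists>D. walk_closure D \<and> thrifty D (marked s) \<and> hits D (marked s) else positive_cycle)"
      \<comment> \<open>The last two phases change neither table nor flag, so both enter as the
        constants of \<open>frame\<close>.\<close>
      by (rule triple_conseq[OF triple_seq[OF triple_forced[of "dmat s0" "var s0 4"] triple_cover]])
        (use s0 in \<open>auto simp: frame_def\<close>)
  qed
  have init: "triple n W (\<lambda>s. var s = (\<lambda>_. 0) \<and> inp s = adjacency) (For 0 Skip) ((1 + 3) * n + 3)
    (\<lambda>s. var s 0 = n \<and> var s 4 = 0 \<and> inp s = adjacency)"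
  proof -
    have "triple n W (\<lambda>s. var s = (\<lambda>_. 0) \<and> inp s = adjacency) (For 0 Skip) ((1 + 3) * n + 3)
      (\<lambda>s. (var s 4 = 0 \<and> inp s = adjacency) \<and> var s 0 = n)"
    proof (rule triple_for[where I = "\<lambda>_ s. var s 4 = 0 \<and> inp s = adjacency"])
      show "triple n W (\<lambda>s. (var s 4 = 0 \<and> inp s = adjacency) \<and> var s 0 = k) Skip 1
        (\<lambda>s. (var (s\<lparr>var := (var s)(0 := Suc k)\<rparr>) 4 = 0 \<and>
          inp (s\<lparr>var := (var s)(0 := Suc k)\<rparr>) = adjacency) \<and> var s 0 = k)" for k
        by (rule triple_conseq[OF triple_skip]) auto
    qed auto
    then show ?thesis
      by (rule triple_conseq) auto
  qed
  show ?thesis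
    unfolding main_prog_def
    by (rule triple_conseq[OF triple_seq[OF init triple_seq[OF triple_mates triple_seq[OF triple_arcs
      triple_seq[OF triple_closure cover]]]]]) (auto simp: power3_eq_cube algebra_simps)
qed

lemma algorithm_run:
  "\<exists>t m. exec (Seq main_prog answer_prog) (encode n E w M) t m \<and> t \<le> 52 * (n + 1) ^ 3 \<and>
    (decode n m = None \<and> positive_cycle \<or>
     (\<exists>D R. decode n m = Some R \<and> walk_closure D \<and> thrifty D R \<and> hits D R))"
proof -
  obtain t m s where run: "exec main_prog (encode n E w M) t m" "t \<le> 50 * (n + 1) ^ 3"
    and R: "represents n W s m"
    and post: "if var s 4 = 0 then \<exists>D. walk_closure D \<and> thrifty D (marked s) \<and> hits D (marked s) else positive_cycle"
    using triple_main represents_encode unfolding triple_def by (metis (no_types, lifting) select_convs(1,3))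
  \<comment> \<open>The marks occupy the cells from 1 on and survive the overwriting of cell
    0.\<close>
  let ?m = "((fst m)(0 := of_bool (var s 4 = 0)), snd m)"
  have "exec answer_prog m (Suc 1) ?m"
  proof (cases "var s 4 = 0")
    case True
    then have "cval (NEq (Val 4) (NConst 0)) m"
      using nval_Val[OF R, of 4] by simp
    then show ?thesis
      unfolding answer_prog_def using exec.CondTrue exec.NStore[of "NConst 0" "NConst 1" m] True by fastforce
  next
    case False
    then have "\<not> cval (NEq (Val 4) (NConst 0)) m"
      using nval_Val[OF R, of 4] by simp
    then show ?thesis
      unfolding answer_prog_def using exec.CondFalse exec.NStore[of "NConst 0" "NConst 0" m] False by fastforce
  qed
  then have "exec (Seq main_prog answer_prog) (encode n E w M) (t + Suc 1) ?m"
    using run(1) exec.Seq by blast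
  moreover have "t + Suc 1 \<le> 52 * (n + 1) ^ 3"
  proof -
    have "1 \<le> (n + 1) ^ 3"
      by simp
    then show ?thesis
      using run(2) by linarith
  qed
  moreover have "decode n ?m = (if var s 4 = 0 then Some (marked s) else None)"
  proof -
    have "fst m (v + 1) = inp s 0 v" if "v < n" for v
    proof -
      have "0 < n"
        using that by simp
      moreover have "\<forall>i<n. \<forall>j<n. i = 0 \<or> i \<noteq> j \<longrightarrow> fst m (1 + i * n + j) = inp s i j"
        using R unfolding represents_def by (elim conjE)
      ultimately have "fst m (1 + 0 * n + v) = inp s 0 v"
        using that by blast
      then show ?thesis
        by simp
    qed
    then show ?thesis
      by (auto simp: decode_def marked_def)
  qed
  moreover have "(if var s 4 = 0 then Some (marked s) else None) = None \<and> positive_cycle \<or>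
     (\<exists>D R. (if var s 4 = 0 then Some (marked s) else None) = Some R \<and>
       walk_closure D \<and> thrifty D R \<and> hits D R)"
    using post by (cases "var s 4 = 0") auto
  ultimately show ?thesis
    by metis
qed

section \<open>Correctness of the answers\<close>

lemma infeasible:
  assumes positive_cycle
  shows "\<not> vertex_stabilizer {..<n} E w M S"
proof
  assume S: "vertex_stabilizer {..<n} E w M S"
  obtain k us where k: "covered M k" "\<forall>u\<in>set us. covered M u" "0 < walk_weight k us k"
    using assms by (auto simp: positive_cycle_def)
  \<comment> \<open>A stabilizer removes exposed vertices only, so it cannot destroy a closed walk
    through covered vertices.\<close>
  have "k \<in> {..<n} - S"
    using k(1) covered_less vertex_stabilizer_exposed[OF S] by auto
  then show False
    using stabilizer_walk_nonpos[OF S _ _ k(2)] k(3) by fastforce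
qed

text \<open>Table entries are weights of walks with covered interior. A positive entry whose ends
  both survive would contradict \<open>stabilizer_walk_nonpos\<close>.\<close>

lemma stabilizer_hits:
  assumes D: "walk_closure D" and S: "vertex_stabilizer {..<n} E w M S"
  shows "hits D S"
proof -
  have nonpos: "D i j \<le> 0" if ij: "i \<in> {..<n} - S" "j \<in> {..<n} - S" "i = j \<or> exposed M i \<and> exposed M j" for i j
  proof -
    obtain us where "\<forall>u\<in>set us. covered M u" "D i j = walk_weight i us j"
      using D ij unfolding walk_closure_def by blast
    then show ?thesis
      using stabilizer_walk_nonpos[OF S ij(1,2)] ij(3) by auto
  qed
  have "v \<in> S" if "v \<in> forced D" for v
    using nonpos[of v v] that by (force simp: forced_def)
  moreover have "x \<in> S \<or> z \<in> S" if "conflict D x z" for x z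
    using nonpos[of x z] that by (force simp: conflict_def)
  ultimately show ?thesis
    by (auto simp: hits_def)
qed

lemma hitting_set_stabilizer:
  assumes D: "walk_closure D" and R: "thrifty D R" "hits D R"
  shows "vertex_stabilizer {..<n} E w M R"
proof (rule stabilizer_of_walk_closure[OF D])
  show "R \<subseteq> {..<n}"
    using R by (simp add: thrifty_def)
  show "exposed M v" if v: "v \<in> R" for v
  proof
    \<comment> \<open>\<open>thrifty\<close> admits covered vertices only if they are forced, and
      the closure has no positive diagonal entry at a covered vertex.\<close>
    assume cov: "covered M v"
    then have "v \<in> forced D"
      using R(1) v unfolding thrifty_def by blast
    moreover have "D v v \<le> 0"
      using D cov unfolding walk_closure_def by blast
    ultimately show False
      by (simp add: forced_def)
  qed
  show "D x z \<le> 0" if "x \<in> {..<n} - R" "z \<in> {..<n} - R" "exposed M x" "exposed M z" for x z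
    using that R(2) by (force simp: hits_def conflict_def)
qed

text \<open>All of \<open>S1\<close> is forced, so a conflict without a forced end would lie outside
  \<open>S1\<close>, where \<open>no_conflict\<close> excludes it.\<close>

lemma forced_hits:
  assumes D: "walk_closure D"
    and mx: "max_weight_matching (induced_edges E ({..<n} - S1 {..<n} E w M)) w M"
  shows "hits D (forced D)"
proof -
  let ?S = "S1 {..<n} E w M"
  have S1: "v \<in> forced D \<and> exposed M v" if "v \<in> ?S" for v
    using S1_closure[OF D that] by (auto simp: forced_def)
  have "x \<in> forced D \<or> z \<in> forced D" if c: "conflict D x z" for x z
  proof (rule ccontr)
    assume "\<not> (x \<in> forced D \<or> z \<in> forced D)"
    then have "x \<in> {..<n} - ?S" "z \<in> {..<n} - ?S" "D x x \<le> 0" "D z z \<le> 0"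
      using c S1 by (auto simp: conflict_def forced_def)
    moreover have "?S \<subseteq> {v. exposed M v}"
      using S1 by blast
    ultimately have "D x z \<le> 0"
      using c no_conflict[OF D _ mx] by (auto simp: conflict_def)
    then show False
      using c by (simp add: conflict_def)
  qed
  then show ?thesis
    by (auto simp: hits_def)
qed

lemma thrifty_bound:
  assumes "thrifty D R" "hits D T" "finite T"
  shows "card R \<le> 2 * card T"
proof -
  have "card R \<le> 2 * card (T \<inter> R)"
    using assms by (auto simp: thrifty_def)
  moreover have "card (T \<inter> R) \<le> card T"
    using assms(3) by (intro card_mono) auto
  ultimately show ?thesis
    by linarith
qed

end

text \<open>One program serves both claims: its 2-approximate answer is already optimal under the
  additional assumption on \<open>M\<close>.\<close>

lemma algorithm_answer:
  assumes "stabilizer_instance {..<n} E w M"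
  shows "\<exists>t m. exec (Seq main_prog answer_prog) (encode n E w M) t m \<and> t \<le> 52 * (n + 1) ^ 3 \<and>
    approx_answer 2 {..<n} E w M (decode n m) \<and>
    (max_weight_matching (induced_edges E ({..<n} - S1 {..<n} E w M)) w M \<longrightarrow>
      optimal_answer {..<n} E w M (decode n m))"
proof -
  interpret nat_stabilizer_problem n E w M
    using assms by unfold_locales
  have fin: "finite T" if "vertex_stabilizer {..<n} E w M T" for T
    using that finite_subset by (auto simp: vertex_stabilizer_def)
  obtain t m where run: "exec (Seq main_prog answer_prog) (encode n E w M) t m" "t \<le> 52 * (n + 1) ^ 3"
    and result: "decode n m = None \<and> positive_cycle \<or>
     (\<exists>D R. decode n m = Some R \<and> walk_closure D \<and> thrifty D R \<and> hits D R)"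
    using algorithm_run by blast
  have "approx_answer 2 {..<n} E w M (decode n m) \<and>
    (max_weight_matching (induced_edges E ({..<n} - S1 {..<n} E w M)) w M \<longrightarrow>
      optimal_answer {..<n} E w M (decode n m))"
    using result
  proof (elim disjE exE conjE)
    assume "decode n m = None" positive_cycle
    then show ?thesis
      using infeasible by (simp add: approx_answer_def optimal_answer_def)
  next
    fix D R assume R: "decode n m = Some R" "walk_closure D" "thrifty D R" "hits D R"
    have "real (card R) \<le> 2 * real (card T)" if "vertex_stabilizer {..<n} E w M T" for T
      using thrifty_bound[OF R(3) stabilizer_hits[OF R(2) that] fin[OF that]] by linarith
    then have "approx_answer 2 {..<n} E w M (decode n m)"
      using R hitting_set_stabilizer by (simp add: approx_answer_def)
    moreover have "optimal_answer {..<n} E w M (decode n m)"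
      if mx: "max_weight_matching (induced_edges E ({..<n} - S1 {..<n} E w M)) w M"
    proof -
      have "R = forced D"
        using R(3) forced_hits[OF R(2) mx] by (simp add: thrifty_def)
      then have "card R \<le> card T" if "vertex_stabilizer {..<n} E w M T" for T
        using stabilizer_hits[OF R(2) that] fin[OF that] by (auto simp: hits_def intro: card_mono)
      then show ?thesis
        using R hitting_set_stabilizer by (simp add: optimal_answer_def)
    qed
    ultimately show ?thesis
      by blast
  qed
  then show ?thesis
    using run by blast
qed

text \<open>The bound depends on \<open>n\<close> alone and carries over to
  \<open>n + card E\<close> by monotonicity.\<close>

lemma poly_time_algorithmI:
  assumes "\<And>n E w M. I {..<n} E w M \<Longrightarrow>
    \<exists>t m. exec p (encode n E w M) t m \<and> t \<le> 52 * (n + 1) ^ 3 \<and> A {..<n} E w M (decode n m)"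
  shows "poly_time_algorithm I A"
proof -
  let ?b = "[:52:] * [:1, 1:] ^ 3 :: nat poly"
  have "52 * (n + 1) ^ 3 \<le> poly ?b (n + k)" for n k
    by (simp add: poly_power power_mono)
  then show ?thesis
    unfolding poly_time_algorithm_def using assms by (meson le_trans)
qed

theorem theorem13:
  shows "poly_time_algorithm stabilizer_instance (approx_answer 2) \<and>
    poly_time_algorithm
      (\<lambda>V E w M. stabilizer_instance V E w M \<and>
         max_weight_matching (induced_edges E (V - S1 V E w M)) w M)
      optimal_answer"
proof
  show "poly_time_algorithm stabilizer_instance (approx_answer 2)"
    using algorithm_answer by (intro poly_time_algorithmI) blast
  show "poly_time_algorithm
      (\<lambda>V E w M. stabilizer_instance V E w M \<and>
         max_weight_matching (induced_edges E (V - S1 V E w M)) w M)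
      optimal_answer"
    using algorithm_answer by (intro poly_time_algorithmI) blast
qed

end
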